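(* Let $A$ and $B$ be Banach algebras with bounded approximate identities and let $(E^{<},E^{>})$ be a Morita equivalence between them. Let $I$ be a closed two-sided ideal of $B$ and $J=\operatorname{Ind}_B^A(I)$, a closed two-sided ideal of $A$. Then $A/J$ and $B/I$ are Morita equivalent. More precisely, the quotient bimodules $$\overline E^{>}:=E^{>}/E_I^{>},\qquad \overline E^{<}:=E^{<}/{}_IE^{<}$$ form a Morita equivalence $(\overline E^{<},\overline E^{>})$ between $A/J$ and $B/I$, with pairings induced from the original pairings, i.e. $\langle[\eta],[\xi]\rangle_{B/I}=\langle\eta,\xi\rangle_B+I$ and ${}_{A/J}\langle[\xi],[\eta]\rangle={}_A\langle\xi,\eta\rangle+J$ for $\xi\in E^{>}$, $\eta\in E^{<}$.
   Context: All Banach spaces and Banach algebras are complex, and all Banach module actions are contractive. For a subset $S$ of a Banach space, $\overline{\operatorname{span}}\,S$ is its closed linear span. For sets $S,T$ a pairing symbol applied to $(S,T)$ denotes the set of all values on $S\times T$. Quotients carry the quotient norms and the induced module actions. A bounded approximate identity in a Banach algebra $A$ is a net $(u_\lambda)$ with $\sup_\lambda\|u_\lambda\|<\infty$ and $u_\lambda a\to a$, $au_\lambda\to a$ for every $a\in A$. A Morita equivalence $(E^{<},E^{>})$ between Banach algebras $A$ and $B$ consists of a Banach $B$-$A$-bimodule $E^{<}$, a Banach $A$-$B$-bimodule $E^{>}$, and continuous bilinear pairings $\langle\cdot,\cdot\rangle_B:E^{<}\times E^{>}\to B$ and ${}_A\langle\cdot,\cdot\rangle:E^{>}\times E^{<}\to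 A$ of norm at most one such that, for all $e^{<},f^{<}\in E^{<}$, $e^{>},f^{>}\in E^{>}$, $a\in A$, $b\in B$: (i) $\langle be^{<},e^{>}\rangle_B=b\langle e^{<},e^{>}\rangle_B$, $\langle e^{<},e^{>}b\rangle_B=\langle e^{<},e^{>}\rangle_Bb$, ${}_A\langle ae^{>},e^{<}\rangle=a\,{}_A\langle e^{>},e^{<}\rangle$, ${}_A\langle e^{>},e^{<}a\rangle={}_A\langle e^{>},e^{<}\rangle a$; (ii) $\langle e^{<}a,e^{>}\rangle_B=\langle e^{<},ae^{>}\rangle_B$, ${}_A\langle e^{>}b,e^{<}\rangle={}_A\langle e^{>},be^{<}\rangle$; (iii) $\langle e^{<},e^{>}\rangle_Bf^{<}=e^{<}\,{}_A\langle e^{>},f^{<}\rangle$, $e^{>}\langle f^{<},f^{>}\rangle_B={}_A\langle e^{>},f^{<}\rangle f^{>}$; (iv) both pairings are full: $\overline{\operatorname{span}}\,\langle E^{<},E^{>}\rangle_B=B$ and $\overline{\operatorname{span}}\,{}_A\langle E^{>},E^{<}\rangle=A$; (v) all four module actions are nondegenerate, i.e. the linear span of the module products is dense in the module. For a closed two-sided ideal $I$ of $B$ put $E_I^{>}=\{\xi\in E^{>}:\langle\eta,\xi\rangle_B\in I\ \forall\eta\in E^{<}\}$, ${}_IE^{<}=\{\eta\in E^{<}:\langle\eta,\xi\rangle_B\in I\ \forall\xi\in E^{>}\}$ and $\operatorname{Ind}_B^A(I)=\overline{\operatorname{span}}\,{}_A\langle E_I^{>},E^{<}\rangle$. *)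

theory Defs
  imports
    "HOL-Analysis.Analysis"
    "HOL-Algebra.Algebraic_Closure_Type"
    "HOL-Algebra.QuotRing"
begin

text \<open>
  The quotients in question depend on an ideal or submodule given as a term, so Banach spaces are
  explicit structures with a carrier: modules, in the sense of HOL-Algebra, over the field of complex
  numbers, together with a norm. The multiplicative fields of the record are only meaningful for
  algebras, and the field \<^const>\<open>monoid.one\<close> carries no meaning: Banach algebras need not be unital,
  which also rules out the locales \<^locale>\<open>ring\<close> and \<^locale>\<open>ideal\<close>.
\<close>

abbreviation complex_field :: "complex ring" (\<open>\<CC>\<close>)
  where "\<CC> \<equiv> ring_of_type_algebra"

record 'a normed_struct = "(complex, 'a) module" +
  vnorm :: "'a \<Rightarrow> real"

text \<open>The locale \<^locale>\<open>Metric_space\<close> wants nonnegativity and symmetry also off the carrier, hence the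
  value \<open>0\<close> there.\<close>

definition vdist :: "'a normed_struct \<Rightarrow> 'a \<Rightarrow> 'a \<Rightarrow> real"
  where "vdist V x y = (if x \<in> carrier V \<and> y \<in> carrier V then vnorm V (x \<ominus>\<^bsub>V\<^esub> y) else 0)"

abbreviation norm_topology :: "'a normed_struct \<Rightarrow> 'a topology"
  where "norm_topology V \<equiv> Metric_space.mtopology (carrier V) (vdist V)"

locale complex_banach_space = Module.module \<CC> V for V :: "'a normed_struct" (structure) +
  assumes vnorm_nonneg: "x \<in> carrier V \<Longrightarrow> 0 \<le> vnorm V x"
    and vnorm_eq_0_iff: "x \<in> carrier V \<Longrightarrow> vnorm V x = 0 \<longleftrightarrow> x = \<zero>"
    and vnorm_triangle:
      "\<lbrakk>x \<in> carrier V; y \<in> carrier V\<rbrakk> \<Longrightarrow> vnorm V (x \<oplus> y) \<le> vnorm V x + vnorm V y"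
    and vnorm_smult: "x \<in> carrier V \<Longrightarrow> vnorm V (c \<odot> x) = cmod c * vnorm V x"
    and complete: "Metric_space.mcomplete (carrier V) (vdist V)"

definition linear_span :: "'a normed_struct \<Rightarrow> 'a set \<Rightarrow> 'a set"
  where "linear_span V S = \<Inter>{H. submodule H \<CC> V \<and> S \<subseteq> H}"

definition closed_span :: "'a normed_struct \<Rightarrow> 'a set \<Rightarrow> 'a set"
  where "closed_span V S = norm_topology V closure_of linear_span V S"

definition contractive_bilinear ::
    "'a normed_struct \<Rightarrow> 'b normed_struct \<Rightarrow> 'c normed_struct \<Rightarrow> ('a \<Rightarrow> 'b \<Rightarrow> 'c) \<Rightarrow> bool"
  where "contractive_bilinear U V W p \<longleftrightarrow>
    (\<forall>x\<in>carrier U. \<forall>y\<in>carrier V. p x y \<in> carrier W \<and> vnorm W (p x y) \<le> vnorm U x * vnorm V y) \<and>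
    (\<forall>x\<in>carrier U. \<forall>x'\<in>carrier U. \<forall>y\<in>carrier V. p (x \<oplus>\<^bsub>U\<^esub> x') y = p x y \<oplus>\<^bsub>W\<^esub> p x' y) \<and>
    (\<forall>x\<in>carrier U. \<forall>y\<in>carrier V. \<forall>y'\<in>carrier V. p x (y \<oplus>\<^bsub>V\<^esub> y') = p x y \<oplus>\<^bsub>W\<^esub> p x y') \<and>
    (\<forall>c. \<forall>x\<in>carrier U. \<forall>y\<in>carrier V.
       p (c \<odot>\<^bsub>U\<^esub> x) y = c \<odot>\<^bsub>W\<^esub> p x y \<and> p x (c \<odot>\<^bsub>V\<^esub> y) = c \<odot>\<^bsub>W\<^esub> p x y)"

locale banach_algebra = complex_banach_space A for A :: "'a normed_struct" (structure) +
  assumes mult_bilinear: "contractive_bilinear A A A (\<lambda>x y. x \<otimes> y)"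
    and mult_assoc: "\<lbrakk>x \<in> carrier A; y \<in> carrier A; z \<in> carrier A\<rbrakk>
      \<Longrightarrow> (x \<otimes> y) \<otimes> z = x \<otimes> (y \<otimes> z)"

text \<open>The net \<open>u\<close> is indexed by the set \<open>D\<close>, directed by the preorder \<open>dle\<close>.\<close>

definition bounded_approximate_identity ::
    "'a normed_struct \<Rightarrow> 'i set \<Rightarrow> ('i \<Rightarrow> 'i \<Rightarrow> bool) \<Rightarrow> ('i \<Rightarrow> 'a) \<Rightarrow> bool"
  where "bounded_approximate_identity A D dle u \<longleftrightarrow>
    D \<noteq> {} \<and>
    (\<forall>i\<in>D. dle i i) \<and>
    (\<forall>i\<in>D. \<forall>j\<in>D. \<forall>k\<in>D. dle i j \<longrightarrow> dle j k \<longrightarrow> dle i k) \<and>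
    (\<forall>i\<in>D. \<forall>j\<in>D. \<exists>k\<in>D. dle i k \<and> dle j k) \<and>
    (\<forall>i\<in>D. u i \<in> carrier A) \<and>
    (\<exists>C. \<forall>i\<in>D. vnorm A (u i) \<le> C) \<and>
    (\<forall>a\<in>carrier A. \<forall>\<epsilon>>0. \<exists>i\<in>D. \<forall>j\<in>D. dle i j \<longrightarrow>
       vnorm A (u j \<otimes>\<^bsub>A\<^esub> a \<ominus>\<^bsub>A\<^esub> a) < \<epsilon> \<and> vnorm A (a \<otimes>\<^bsub>A\<^esub> u j \<ominus>\<^bsub>A\<^esub> a) < \<epsilon>)"

definition closed_ideal :: "'a normed_struct \<Rightarrow> 'a set \<Rightarrow> bool"
  where "closed_ideal A I \<longleftrightarrow>
    submodule I \<CC> A \<and>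
    (\<forall>a\<in>carrier A. \<forall>x\<in>I. a \<otimes>\<^bsub>A\<^esub> x \<in> I \<and> x \<otimes>\<^bsub>A\<^esub> a \<in> I) \<and>
    closedin (norm_topology A) I"

text \<open>Banach \<open>L\<close>-\<open>R\<close>-bimodules: \<open>l a x\<close> is \<open>a x\<close> and \<open>r x b\<close> is \<open>x b\<close>.\<close>

locale banach_bimodule =
  L: banach_algebra L + R: banach_algebra R + E: complex_banach_space E
  for L :: "'a normed_struct" and R :: "'b normed_struct" and E :: "'e normed_struct"
    and l :: "'a \<Rightarrow> 'e \<Rightarrow> 'e" and r :: "'e \<Rightarrow> 'b \<Rightarrow> 'e" +
  assumes left_bilinear: "contractive_bilinear L E E l"
    and right_bilinear: "contractive_bilinear E R E r"
    and left_assoc: "\<lbrakk>a \<in> carrier L; a' \<in> carrier L; x \<in> carrier E\<rbrakk>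
      \<Longrightarrow> l (a \<otimes>\<^bsub>L\<^esub> a') x = l a (l a' x)"
    and right_assoc: "\<lbrakk>x \<in> carrier E; b \<in> carrier R; b' \<in> carrier R\<rbrakk>
      \<Longrightarrow> r x (b \<otimes>\<^bsub>R\<^esub> b') = r (r x b) b'"
    and left_right: "\<lbrakk>a \<in> carrier L; x \<in> carrier E; b \<in> carrier R\<rbrakk>
      \<Longrightarrow> r (l a x) b = l a (r x b)"

text \<open>
  \<open>El\<close> and \<open>Er\<close> are \<open>E\<^sup><\<close> and \<open>E\<^sup>>\<close>; \<open>bl\<close> and \<open>la\<close> are the actions of \<open>B\<close> and \<open>A\<close> on \<open>El\<close>, \<open>ar\<close> and \<open>rb\<close>
  those of \<open>A\<close> and \<open>B\<close> on \<open>Er\<close>; \<open>pB\<close> and \<open>pA\<close> are the pairings with values in \<open>B\<close> and \<open>A\<close>.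
\<close>

locale morita_equivalence =
  El: banach_bimodule B A El bl la + Er: banach_bimodule A B Er ar rb
  for A :: "'a normed_struct" and B :: "'b normed_struct"
    and El :: "'e normed_struct" and Er :: "'f normed_struct"
    and bl :: "'b \<Rightarrow> 'e \<Rightarrow> 'e" and la :: "'e \<Rightarrow> 'a \<Rightarrow> 'e"
    and ar :: "'a \<Rightarrow> 'f \<Rightarrow> 'f" and rb :: "'f \<Rightarrow> 'b \<Rightarrow> 'f"
    and pB :: "'e \<Rightarrow> 'f \<Rightarrow> 'b" and pA :: "'f \<Rightarrow> 'e \<Rightarrow> 'a" +
  assumes pB_bilinear: "contractive_bilinear El Er B pB"
    and pA_bilinear: "contractive_bilinear Er El A pA"
    and pB_left: "\<lbrakk>b \<in> carrier B; e \<in> carrier El; x \<in> carrier Er\<rbrakk>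
      \<Longrightarrow> pB (bl b e) x = b \<otimes>\<^bsub>B\<^esub> pB e x"
    and pB_right: "\<lbrakk>e \<in> carrier El; x \<in> carrier Er; b \<in> carrier B\<rbrakk>
      \<Longrightarrow> pB e (rb x b) = pB e x \<otimes>\<^bsub>B\<^esub> b"
    and pA_left: "\<lbrakk>a \<in> carrier A; x \<in> carrier Er; e \<in> carrier El\<rbrakk>
      \<Longrightarrow> pA (ar a x) e = a \<otimes>\<^bsub>A\<^esub> pA x e"
    and pA_right: "\<lbrakk>x \<in> carrier Er; e \<in> carrier El; a \<in> carrier A\<rbrakk>
      \<Longrightarrow> pA x (la e a) = pA x e \<otimes>\<^bsub>A\<^esub> a"
    and pB_balanced: "\<lbrakk>e \<in> carrier El; a \<in> carrier A; x \<in> carrier Er\<rbrakk>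
      \<Longrightarrow> pB (la e a) x = pB e (ar a x)"
    and pA_balanced: "\<lbrakk>x \<in> carrier Er; b \<in> carrier B; e \<in> carrier El\<rbrakk>
      \<Longrightarrow> pA (rb x b) e = pA x (bl b e)"
    and compatible_left: "\<lbrakk>e \<in> carrier El; x \<in> carrier Er; f \<in> carrier El\<rbrakk>
      \<Longrightarrow> bl (pB e x) f = la e (pA x f)"
    and compatible_right: "\<lbrakk>x \<in> carrier Er; f \<in> carrier El; y \<in> carrier Er\<rbrakk>
      \<Longrightarrow> rb x (pB f y) = ar (pA x f) y"
    and pB_full: "closed_span B {pB e x | e x. e \<in> carrier El \<and> x \<in> carrier Er} = carrier B"
    and pA_full: "closed_span A {pA x e | x e. x \<in> carrier Er \<and> e \<in> carrier El} = carrier A"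
    and bl_nondegenerate:
      "closed_span El {bl b e | b e. b \<in> carrier B \<and> e \<in> carrier El} = carrier El"
    and la_nondegenerate:
      "closed_span El {la e a | e a. e \<in> carrier El \<and> a \<in> carrier A} = carrier El"
    and ar_nondegenerate:
      "closed_span Er {ar a x | a x. a \<in> carrier A \<and> x \<in> carrier Er} = carrier Er"
    and rb_nondegenerate:
      "closed_span Er {rb x b | x b. x \<in> carrier Er \<and> b \<in> carrier B} = carrier Er"

definition right_part ::
    "'e normed_struct \<Rightarrow> 'f normed_struct \<Rightarrow> ('e \<Rightarrow> 'f \<Rightarrow> 'b) \<Rightarrow> 'b set \<Rightarrow> 'f set"
  where "right_part El Er pB I = {x \<in> carrier Er. \<forall>e\<in>carrier El. pB e x \<in> I}"

definition left_part ::
    "'e normed_struct \<Rightarrow> 'f normed_struct \<Rightarrow> ('e \<Rightarrow> 'f \<Rightarrow> 'b) \<Rightarrow> 'b set \<Rightarrow> 'e set"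
  where "left_part El Er pB I = {e \<in> carrier El. \<forall>x\<in>carrier Er. pB e x \<in> I}"

definition induced_ideal :: "'a normed_struct \<Rightarrow> 'e normed_struct \<Rightarrow> 'f normed_struct \<Rightarrow>
    ('e \<Rightarrow> 'f \<Rightarrow> 'b) \<Rightarrow> ('f \<Rightarrow> 'e \<Rightarrow> 'a) \<Rightarrow> 'b set \<Rightarrow> 'a set"
  where "induced_ideal A El Er pB pA I =
    closed_span A {pA x e | x e. x \<in> right_part El Er pB I \<and> e \<in> carrier El}"

text \<open>
  The map on cosets induced by \<open>p\<close>, with values in \<open>W / N\<close>; it generalises \<^const>\<open>rcoset_mult\<close>. Its
  value is a single coset exactly when \<open>p\<close> respects the cosets \<open>S\<close> and \<open>T\<close> modulo \<open>N\<close>.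
\<close>

definition induced_map :: "'c normed_struct \<Rightarrow> 'c set \<Rightarrow> ('a \<Rightarrow> 'b \<Rightarrow> 'c) \<Rightarrow>
    'a set \<Rightarrow> 'b set \<Rightarrow> 'c set"
  where "induced_map W N p S T = (\<Union>x\<in>S. \<Union>y\<in>T. N +>\<^bsub>W\<^esub> p x y)"

text \<open>
  The quotient \<open>V / N\<close>, as a Banach space or, if \<open>N\<close> is an ideal, as a Banach algebra. Scalar
  multiplication is not the plain image of a coset, which for the scalar \<open>0\<close> would be \<open>{\<zero>}\<close> instead
  of \<open>N\<close>.
\<close>

definition quotient_struct :: "'a normed_struct \<Rightarrow> 'a set \<Rightarrow> 'a set normed_struct"
  where "quotient_struct V N =
    \<lparr>carrier = a_rcosets\<^bsub>V\<^esub> N, mult = rcoset_mult V N, one = N +>\<^bsub>V\<^esub> \<one>\<^bsub>V\<^esub>, zero = N,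
     add = set_add V, smult = (\<lambda>c S. \<Union>x\<in>S. N +>\<^bsub>V\<^esub> (c \<odot>\<^bsub>V\<^esub> x)),
     vnorm = (\<lambda>S. INF x\<in>S. vnorm V x)\<rparr>"

end

theory Submission
  imports Defs
begin

text \<open>
  Write \<open>N\<^sub>r\<close> and \<open>N\<^sub>l\<close> for the two submodules of the statement. The quotient inherits every identity
  and density property of the original equivalence as soon as all actions and pairings respect cosets,
  and all the inclusions needed for this but one are immediate from the module axioms and continuity.
  The exception is that \<open>pA x e \<in> J\<close> for arbitrary \<open>x\<close> and \<open>e \<in> N\<^sub>l\<close>, because \<open>J\<close> is generated by
  pairings with \<open>N\<^sub>r\<close>. Here \<open>pA x e \<otimes> pA y f = pA x (pB e y \<cdot> f) = pA (x \<cdot> pB e y) f\<close>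
  lies in \<open>J\<close>, since \<open>pB e y \<in> I\<close>; by fullness \<open>pA x e \<otimes> A \<subseteq> J\<close>, and an approximate identity of \<open>A\<close>
  puts \<open>pA x e\<close> itself into the closed set \<open>J\<close>.
\<close>

section \<open>Normed modules over the complex numbers: closures and closed spans\<close>

text \<open>The module axioms speak of scalars through the fields of a ring record. These rules turn
  them into ordinary complex arithmetic.\<close>

lemma complex_field_simps [simp]:
  "carrier \<CC> = UNIV" "mult \<CC> = (*)" "one \<CC> = 1" "zero \<CC> = 0" "add \<CC> = (+)"
  by (simp_all add: ring_of_type_algebra_def fun_eq_iff)

text \<open>This is \<open>complex_banach_space\<close> without completeness. The metric of a
  quotient is needed in the very proof that the quotient is complete, so everything that does not
  depend on completeness is developed here.\<close>

locale normed_module = Module.module \<CC> V for V :: "'a normed_struct" (structure) +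
  assumes vnorm_nonneg: "x \<in> carrier V \<Longrightarrow> 0 \<le> vnorm V x"
    and vnorm_eq_0_iff: "x \<in> carrier V \<Longrightarrow> vnorm V x = 0 \<longleftrightarrow> x = \<zero>"
    and vnorm_triangle:
      "\<lbrakk>x \<in> carrier V; y \<in> carrier V\<rbrakk> \<Longrightarrow> vnorm V (x \<oplus> y) \<le> vnorm V x + vnorm V y"
    and vnorm_smult: "x \<in> carrier V \<Longrightarrow> vnorm V (c \<odot> x) = cmod c * vnorm V x"
begin

lemma vnorm_zero [simp]: "vnorm V \<zero> = 0"
  by (simp add: vnorm_eq_0_iff)

text \<open>With negation as a scalar multiple, norms of negatives and compatibility of maps with
  negation follow from the laws for scalars.\<close>

lemma smult_minus_one: "x \<in> carrier V \<Longrightarrow> (-1) \<odot> x = \<ominus> x"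
proof -
  assume x: "x \<in> carrier V"
  have "(-1) \<odot> x \<oplus> x = (-1 + 1) \<odot> x"
    using smult_l_distr[of "-1" 1 x] smult_one[of x] x by simp
  also have "\<dots> = \<zero>" using smult_l_null[OF x] by simp
  finally show ?thesis using x smult_closed[of "-1" x] by (simp add: M.minus_equality)
qed

lemma smult_diff:
  "\<lbrakk>x \<in> carrier V; y \<in> carrier V\<rbrakk> \<Longrightarrow> c \<odot> x \<ominus> c \<odot> y = c \<odot> (x \<ominus> y)"
  by (simp add: M.minus_eq smult_r_distr smult_r_minus)

lemma vnorm_uminus [simp]: "x \<in> carrier V \<Longrightarrow> vnorm V (\<ominus> x) = vnorm V x"
  using vnorm_smult[of x "-1"] by (simp add: smult_minus_one)

lemma vnorm_minus_commute:
  "\<lbrakk>x \<in> carrier V; y \<in> carrier V\<rbrakk> \<Longrightarrow> vnorm V (x \<ominus> y) = vnorm V (y \<ominus> x)"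
  using vnorm_uminus[of "x \<ominus> y"] by (simp add: M.minus_eq M.minus_add M.a_comm)

lemma minus_eq_zero_iff:
  "\<lbrakk>x \<in> carrier V; y \<in> carrier V\<rbrakk> \<Longrightarrow> x \<ominus> y = \<zero> \<longleftrightarrow> x = y"
  by (metis M.a_inv_closed M.minus_eq M.minus_equality M.minus_minus M.r_neg)

lemma minus_triangle:
  "\<lbrakk>x \<in> carrier V; y \<in> carrier V; z \<in> carrier V\<rbrakk> \<Longrightarrow> (x \<ominus> y) \<oplus> (y \<ominus> z) = x \<ominus> z"
  by (simp add: M.minus_eq M.a_ac M.r_neg1 M.r_neg2)

lemma vnorm_minus_triangle:
  "\<lbrakk>x \<in> carrier V; y \<in> carrier V; z \<in> carrier V\<rbrakk>
    \<Longrightarrow> vnorm V (x \<ominus> z) \<le> vnorm V (x \<ominus> y) + vnorm V (y \<ominus> z)"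
  using vnorm_triangle[of "x \<ominus> y" "y \<ominus> z"] by (simp add: minus_triangle)

sublocale metric: Metric_space "carrier V" "vdist V"
proof
  show "0 \<le> vdist V x y" for x y
    by (simp add: vdist_def vnorm_nonneg)
  show "vdist V x y = vdist V y x" for x y
    by (simp add: vdist_def vnorm_minus_commute)
  show "vdist V x y = 0 \<longleftrightarrow> x = y" if "x \<in> carrier V" "y \<in> carrier V" for x y
    using that by (simp add: vdist_def vnorm_eq_0_iff minus_eq_zero_iff)
  show "vdist V x z \<le> vdist V x y + vdist V y z"
    if "x \<in> carrier V" "y \<in> carrier V" "z \<in> carrier V" for x y z
    using that by (simp add: vdist_def vnorm_minus_triangle)
qed

lemma closure_of_iff:
  "x \<in> norm_topology V closure_of S \<longleftrightarrow>
    x \<in> carrier V \<and> (\<forall>\<epsilon>>0. \<exists>y\<in>S. y \<in> carrier V \<and> vnorm V (x \<ominus> y) < \<epsilon>)"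
  by (auto simp: metric.metric_closure_of vdist_def metric.in_mball)

lemma closedin_iff:
  "closedin (norm_topology V) S \<longleftrightarrow>
    S \<subseteq> carrier V \<and> (\<forall>x\<in>carrier V. (\<forall>\<epsilon>>0. \<exists>y\<in>S. vnorm V (x \<ominus> y) < \<epsilon>) \<longrightarrow> x \<in> S)"
  (is "?L \<longleftrightarrow> ?R")
proof -
  have "?L \<longleftrightarrow> S \<subseteq> carrier V \<and> norm_topology V closure_of S \<subseteq> S"
    using closure_of_subset_eq[of S "norm_topology V"] by simp
  also have "\<dots> \<longleftrightarrow> ?R"
  proof (rule conj_cong[OF refl])
    assume "S \<subseteq> carrier V"
    then have "(\<exists>y\<in>S. y \<in> carrier V \<and> P y) \<longleftrightarrow> (\<exists>y\<in>S. P y)" for P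
      by blast
    then show "norm_topology V closure_of S \<subseteq> S \<longleftrightarrow>
      (\<forall>x\<in>carrier V. (\<forall>\<epsilon>>0. \<exists>y\<in>S. vnorm V (x \<ominus> y) < \<epsilon>) \<longrightarrow> x \<in> S)"
      unfolding subset_iff closure_of_iff Ball_def by (simp add: imp_conjL)
  qed
  finally show ?thesis .
qed

text \<open>The hypothesis makes the carrier one of the submodules intersected. Without it the
  family would be empty and its intersection the whole type.\<close>

lemma submodule_linear_span:
  assumes "S \<subseteq> carrier V"
  shows "submodule (linear_span V S) \<CC> V"
proof (rule submoduleI)
  show "linear_span V S \<subseteq> carrier V"
    using assms carrier_is_submodule unfolding linear_span_def by blast
  show "\<zero> \<in> linear_span V S"
    unfolding linear_span_def using subgroup.one_closed[OF submodule.axioms(1)] by fastforce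
  show "\<ominus> a \<in> linear_span V S" if "a \<in> linear_span V S" for a
    using that submoduleE(3) unfolding linear_span_def by blast
  show "a \<oplus> b \<in> linear_span V S" if "a \<in> linear_span V S" "b \<in> linear_span V S" for a b
    using that submoduleE(5) unfolding linear_span_def by blast
  show "c \<odot> a \<in> linear_span V S" if "c \<in> carrier \<CC>" "a \<in> linear_span V S" for c a
    using that submoduleE(4) unfolding linear_span_def by blast
qed

lemma linear_span_superset: "S \<subseteq> linear_span V S"
  by (auto simp: linear_span_def)

lemma linear_span_least: "submodule H \<CC> V \<Longrightarrow> S \<subseteq> H \<Longrightarrow> linear_span V S \<subseteq> H"
  by (auto simp: linear_span_def)

text \<open>Sums and multiples of approximants from \<open>H\<close> approximate the sums and
  multiples of the limits, and they stay in \<open>H\<close>.\<close>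

lemma submodule_closure_of:
  assumes H: "submodule H \<CC> V"
  shows "submodule (norm_topology V closure_of H) \<CC> V"
proof (rule submoduleI)
  let ?K = "norm_topology V closure_of H"
  note HE = submoduleE[OF H]
  have K: "\<exists>y\<in>H. y \<in> carrier V \<and> vnorm V (x \<ominus> y) < \<epsilon>" if "x \<in> ?K" "\<epsilon> > 0" for x \<epsilon>
    using that unfolding closure_of_iff by blast
  show sub: "?K \<subseteq> carrier V"
    by (auto simp: closure_of_iff)
  have "H \<subseteq> ?K"
    using HE(1) by (simp add: closure_of_subset)
  then show "\<zero> \<in> ?K"
    using H[THEN submodule.axioms(1)] subgroup.one_closed by fastforce
  show add: "x \<oplus> y \<in> ?K" if xK: "x \<in> ?K" and yK: "y \<in> ?K" for x y
    unfolding closure_of_iff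
  proof (intro conjI allI impI)
    show "x \<oplus> y \<in> carrier V" using that sub by auto
    fix \<epsilon> :: real assume "\<epsilon> > 0"
    then obtain x' y' where *: "x' \<in> H" "y' \<in> H" "x' \<in> carrier V" "y' \<in> carrier V"
      "vnorm V (x \<ominus> x') < \<epsilon>/2" "vnorm V (y \<ominus> y') < \<epsilon>/2"
      using K[OF xK, of "\<epsilon>/2"] K[OF yK, of "\<epsilon>/2"] by (metis half_gt_zero)
    have xy: "x \<in> carrier V" "y \<in> carrier V" using that sub by auto
    have eq: "(x \<oplus> y) \<ominus> (x' \<oplus> y') = (x \<ominus> x') \<oplus> (y \<ominus> y')"
      using * xy by (simp add: M.minus_eq M.minus_add M.a_ac)
    have "vnorm V ((x \<oplus> y) \<ominus> (x' \<oplus> y')) < \<epsilon>"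
      using vnorm_triangle[of "x \<ominus> x'" "y \<ominus> y'"] * xy unfolding eq by fastforce
    then show "\<exists>z\<in>H. z \<in> carrier V \<and> vnorm V (x \<oplus> y \<ominus> z) < \<epsilon>"
      using * HE(5) by blast
  qed
  show smult: "c \<odot> x \<in> ?K" if xK: "x \<in> ?K" for c x
    unfolding closure_of_iff
  proof (intro conjI allI impI)
    show "c \<odot> x \<in> carrier V" using that sub by auto
    fix \<epsilon> :: real assume \<epsilon>: "\<epsilon> > 0"
    \<comment> \<open>The summand \<open>1\<close> allows division by this number even when
      \<open>c\<close> is zero.\<close>
    have pos: "cmod c + 1 > 0" by (simp add: add_nonneg_pos)
    then obtain y where y: "y \<in> H" "y \<in> carrier V" "vnorm V (x \<ominus> y) < \<epsilon> / (cmod c + 1)"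
      using K[OF xK, of "\<epsilon> / (cmod c + 1)"] \<epsilon> by auto
    have x: "x \<in> carrier V" using that sub by auto
    have "vnorm V (c \<odot> x \<ominus> c \<odot> y) = cmod c * vnorm V (x \<ominus> y)"
      using x y by (simp add: smult_diff vnorm_smult)
    also have "\<dots> \<le> (cmod c + 1) * vnorm V (x \<ominus> y)"
      using x y by (simp add: vnorm_nonneg mult_right_mono)
    also have "\<dots> < \<epsilon>" using y(3) pos by (simp add: field_simps)
    finally show "\<exists>z\<in>H. z \<in> carrier V \<and> vnorm V (c \<odot> x \<ominus> z) < \<epsilon>"
      using y HE(4) by (metis UNIV_I complex_field_simps(1) smult_closed)
  qed
  show "\<ominus> x \<in> ?K" if "x \<in> ?K" for x
    using smult[OF that, of "-1"] sub that by (auto simp: smult_minus_one)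
qed

lemma submodule_closed_span: "S \<subseteq> carrier V \<Longrightarrow> submodule (closed_span V S) \<CC> V"
  by (simp add: closed_span_def submodule_closure_of submodule_linear_span)

lemma closedin_closed_span: "closedin (norm_topology V) (closed_span V S)"
  by (simp add: closed_span_def)

lemma closed_span_superset:
  assumes "S \<subseteq> carrier V" shows "S \<subseteq> closed_span V S"
proof -
  have "linear_span V S \<subseteq> closed_span V S"
    unfolding closed_span_def
    using submoduleE(1)[OF submodule_linear_span[OF assms]] by (simp add: closure_of_subset)
  then show ?thesis using linear_span_superset by blast
qed

lemma closed_span_least:
  "submodule H \<CC> V \<Longrightarrow> closedin (norm_topology V) H \<Longrightarrow> S \<subseteq> H \<Longrightarrow> closed_span V S \<subseteq> H"
  unfolding closed_span_def by (simp add: closure_of_minimal linear_span_least)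

lemma closed_span_subset_carrier: "closed_span V S \<subseteq> carrier V"
  by (auto simp: closed_span_def closure_of_iff)

end

lemma complex_banach_space_iff:
  "complex_banach_space V \<longleftrightarrow>
    normed_module V \<and> Metric_space.mcomplete (carrier V) (vdist V)"
  by (auto simp: complex_banach_space_def complex_banach_space_axioms_def normed_module_def
      normed_module_axioms_def)

sublocale complex_banach_space \<subseteq> normed_module
  using complex_banach_space_axioms by (simp add: complex_banach_space_iff)

section \<open>Bounded linear maps and closed spans\<close>

text \<open>The main instances fix one argument of a contractive bilinear map, and \<open>C\<close>
  is then the norm of that argument. The coset map is the instance with \<open>C\<close> equal to
  \<open>1\<close>.\<close>

locale bounded_module_map = V: normed_module V + W: normed_module W
  for V :: "'a normed_struct" and W :: "'b normed_struct" +
  fixes f :: "'a \<Rightarrow> 'b" and C :: real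
  assumes map_closed [simp]: "x \<in> carrier V \<Longrightarrow> f x \<in> carrier W"
    and map_add: "\<lbrakk>x \<in> carrier V; y \<in> carrier V\<rbrakk> \<Longrightarrow> f (x \<oplus>\<^bsub>V\<^esub> y) = f x \<oplus>\<^bsub>W\<^esub> f y"
    and map_smult: "x \<in> carrier V \<Longrightarrow> f (c \<odot>\<^bsub>V\<^esub> x) = c \<odot>\<^bsub>W\<^esub> f x"
    and map_bounded: "x \<in> carrier V \<Longrightarrow> vnorm W (f x) \<le> C * vnorm V x"
begin

lemma map_uminus: "x \<in> carrier V \<Longrightarrow> f (\<ominus>\<^bsub>V\<^esub> x) = \<ominus>\<^bsub>W\<^esub> f x"
  using map_smult[of x "-1"] by (simp add: V.smult_minus_one W.smult_minus_one)

lemma map_minus: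
  "\<lbrakk>x \<in> carrier V; y \<in> carrier V\<rbrakk> \<Longrightarrow> f (x \<ominus>\<^bsub>V\<^esub> y) = f x \<ominus>\<^bsub>W\<^esub> f y"
  by (simp add: V.M.minus_eq W.M.minus_eq map_add map_uminus)

lemma map_zero: "f \<zero>\<^bsub>V\<^esub> = \<zero>\<^bsub>W\<^esub>"
  using map_smult[of "\<zero>\<^bsub>V\<^esub>" 0] V.smult_l_null W.smult_l_null by simp

lemma submodule_vimage:
  assumes H: "submodule H \<CC> W"
  shows "submodule {x \<in> carrier V. f x \<in> H} \<CC> V"
  using W.submoduleE[OF H] subgroup.one_closed[OF submodule.axioms(1)[OF H]]
  by (intro V.submoduleI) (auto simp: map_add map_smult map_uminus map_zero)

lemma closedin_vimage:
  assumes H: "closedin (norm_topology W) H"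
  shows "closedin (norm_topology V) {x \<in> carrier V. f x \<in> H}"
  unfolding V.closedin_iff
proof (intro conjI ballI impI CollectI)
  fix x assume x: "x \<in> carrier V"
    and lim: "\<forall>\<epsilon>>0. \<exists>y\<in>{x \<in> carrier V. f x \<in> H}. vnorm V (x \<ominus>\<^bsub>V\<^esub> y) < \<epsilon>"
  have "\<exists>z\<in>H. vnorm W (f x \<ominus>\<^bsub>W\<^esub> z) < \<epsilon>" if \<epsilon>: "\<epsilon> > 0" for \<epsilon>
  proof -
    \<comment> \<open>No sign is assumed for \<open>C\<close>; this number is a positive upper bound
      of it.\<close>
    have pos: "\<bar>C\<bar> + 1 > 0" by (simp add: add_nonneg_pos)
    then obtain y where y: "y \<in> carrier V" "f y \<in> H" "vnorm V (x \<ominus>\<^bsub>V\<^esub> y) < \<epsilon> / (\<bar>C\<bar> + 1)"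
      using lim[rule_format, of "\<epsilon> / (\<bar>C\<bar> + 1)"] \<epsilon> by auto
    have "vnorm W (f x \<ominus>\<^bsub>W\<^esub> f y) \<le> C * vnorm V (x \<ominus>\<^bsub>V\<^esub> y)"
      using map_bounded[of "x \<ominus>\<^bsub>V\<^esub> y"] x y by (simp add: map_minus)
    also have "\<dots> \<le> (\<bar>C\<bar> + 1) * vnorm V (x \<ominus>\<^bsub>V\<^esub> y)"
      using x y by (intro mult_right_mono) (auto simp: V.vnorm_nonneg)
    also have "\<dots> < \<epsilon>" using y(3) pos by (simp add: field_simps)
    finally show ?thesis using y by blast
  qed
  then show "x \<in> carrier V" "f x \<in> H"
    using x H unfolding W.closedin_iff by auto
qed auto

text \<open>The preimage of a closed submodule is a closed submodule, so it contains the closed span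
  of \<open>S\<close> as soon as it contains \<open>S\<close>. This carries memberships checked on
  generators over to all limits of their linear combinations.\<close>

lemma image_closed_span:
  assumes "submodule H \<CC> W" "closedin (norm_topology W) H" "S \<subseteq> carrier V" "f ` S \<subseteq> H"
    and "x \<in> closed_span V S"
  shows "f x \<in> H"
  using V.closed_span_least[OF submodule_vimage closedin_vimage, of H S] assms by auto

end

lemma contractive_bilinear_left_map:
  assumes "contractive_bilinear U V W p" "normed_module U" "normed_module W" "y \<in> carrier V"
  shows "bounded_module_map U W (\<lambda>x. p x y) (vnorm V y)"
  using assms
  by (auto simp: bounded_module_map_def bounded_module_map_axioms_def contractive_bilinear_def
      mult.commute)

lemma contractive_bilinear_right_map:
  assumes "contractive_bilinear U V W p" "normed_module V" "normed_module W" "x \<in> carrier U"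
  shows "bounded_module_map V W (p x) (vnorm U x)"
  using assms
  by (auto simp: bounded_module_map_def bounded_module_map_axioms_def contractive_bilinear_def)

section \<open>The quotient of a normed module by a closed submodule\<close>

locale closed_submodule = normed_module V for V :: "'a normed_struct" (structure) +
  fixes N :: "'a set"
  assumes submodule_N: "submodule N \<CC> V"
    and closedin_N: "closedin (norm_topology V) N"
begin

sublocale N: abelian_subgroup N V
  using submodule.axioms(1)[OF submodule_N]
  by (auto intro: abelian_subgroupI3 additive_subgroup.intro M.abelian_group_axioms)

abbreviation coset :: "'a \<Rightarrow> 'a set"
  where "coset x \<equiv> N +> x"

abbreviation Q :: "'a set normed_struct"
  where "Q \<equiv> quotient_struct V N"

lemma coset_eq_iff:
  "\<lbrakk>x \<in> carrier V; y \<in> carrier V\<rbrakk> \<Longrightarrow> coset x = coset y \<longleftrightarrow> x \<ominus> y \<in> N"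
  unfolding M.minus_eq
  by (metis N.a_rcos_module N.a_rcos_self N.a_repr_independence')

lemma mem_coset_iff: "x \<in> carrier V \<Longrightarrow> y \<in> coset x \<longleftrightarrow> y \<in> carrier V \<and> coset y = coset x"
  by (metis N.a_elemrcos_carrier N.a_rcos_self N.a_repr_independence')

lemma carrier_quotient: "carrier Q = coset ` carrier V"
  by (auto simp: quotient_struct_def A_RCOSETS_def')

lemma coset_in_carrier [simp]: "x \<in> carrier V \<Longrightarrow> coset x \<in> carrier Q"
  by (simp add: carrier_quotient)

lemma carrier_quotientE:
  assumes "S \<in> carrier Q" obtains x where "x \<in> carrier V" "S = coset x"
  using assms by (auto simp: carrier_quotient)

lemma zero_quotient: "\<zero>\<^bsub>Q\<^esub> = coset \<zero>"
  using N.a_rcos_const[of \<zero>] by (simp add: quotient_struct_def)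

lemma add_quotient:
  "\<lbrakk>x \<in> carrier V; y \<in> carrier V\<rbrakk> \<Longrightarrow> coset x \<oplus>\<^bsub>Q\<^esub> coset y = coset (x \<oplus> y)"
  by (simp add: quotient_struct_def N.a_rcos_sum)

text \<open>The union defining the scalar multiple runs over a nonempty coset, and all its members
  are the same coset because \<open>N\<close> is closed under scalars.\<close>

lemma smult_quotient:
  assumes "x \<in> carrier V" shows "c \<odot>\<^bsub>Q\<^esub> coset x = coset (c \<odot> x)"
proof -
  have "coset (c \<odot> y) = coset (c \<odot> x)" if "y \<in> coset x" for y
    using that assms coset_eq_iff[of y x] submoduleE(4)[OF submodule_N]
    by (simp add: mem_coset_iff coset_eq_iff smult_diff)
  then have "(\<Union>y\<in>coset x. coset (c \<odot> y)) = coset (c \<odot> x)"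
    using N.a_rcos_self[OF assms] by (intro SUP_eq_const) blast+
  then show ?thesis by (simp add: quotient_struct_def)
qed

lemma vnorm_quotient: "vnorm Q S = (INF x\<in>S. vnorm V x)"
  by (simp add: quotient_struct_def)

lemma vnorm_quotient_le:
  assumes "x \<in> carrier V" shows "vnorm Q (coset x) \<le> vnorm V x"
  unfolding vnorm_quotient
proof (rule cINF_lower[OF _ N.a_rcos_self[OF assms]])
  show "bdd_below (vnorm V ` coset x)"
    using assms by (intro bdd_belowI[of _ 0]) (auto simp: mem_coset_iff vnorm_nonneg)
qed

lemma vnorm_quotient_greatest:
  assumes "x \<in> carrier V"
    and "\<And>y. \<lbrakk>y \<in> carrier V; coset y = coset x\<rbrakk> \<Longrightarrow> t \<le> vnorm V y"
  shows "t \<le> vnorm Q (coset x)"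
  unfolding vnorm_quotient
  using assms N.a_rcos_self[OF assms(1)] by (intro cINF_greatest) (auto simp: mem_coset_iff)

text \<open>The infimum over a coset need not be attained, so a representative is available only
  below a strict upper bound \<open>t\<close>.\<close>

lemma vnorm_quotient_approx:
  assumes "x \<in> carrier V" "vnorm Q (coset x) < t"
  obtains y where "y \<in> carrier V" "coset y = coset x" "vnorm V y < t"
  using vnorm_quotient_greatest[OF assms(1), of t] assms(2) by (meson not_less)

lemma quotient_module: "Module.module \<CC> Q"
proof (rule moduleI)
  show "cring \<CC>" by (rule R.is_cring)
  show "abelian_group Q"
  proof (rule abelian_groupI)
    fix S assume "S \<in> carrier Q"
    then obtain x where x: "x \<in> carrier V" and S: "S = coset x" by (rule carrier_quotientE)
    show "\<zero>\<^bsub>Q\<^esub> \<oplus>\<^bsub>Q\<^esub> S = S"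
      using x by (simp add: S zero_quotient add_quotient)
    have "coset (\<ominus> x) \<oplus>\<^bsub>Q\<^esub> S = \<zero>\<^bsub>Q\<^esub>"
      using x by (simp add: S add_quotient zero_quotient M.l_neg)
    then show "\<exists>T\<in>carrier Q. T \<oplus>\<^bsub>Q\<^esub> S = \<zero>\<^bsub>Q\<^esub>"
      using x by (metis M.a_inv_closed coset_in_carrier)
    fix T assume "T \<in> carrier Q"
    then obtain y where y: "y \<in> carrier V" and T: "T = coset y" by (rule carrier_quotientE)
    show "S \<oplus>\<^bsub>Q\<^esub> T \<in> carrier Q"
      using x y by (simp add: S T add_quotient)
    show "S \<oplus>\<^bsub>Q\<^esub> T = T \<oplus>\<^bsub>Q\<^esub> S"
      using x y by (simp add: S T add_quotient M.a_comm)
    fix U assume "U \<in> carrier Q"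
    then obtain z where z: "z \<in> carrier V" and U: "U = coset z" by (rule carrier_quotientE)
    show "S \<oplus>\<^bsub>Q\<^esub> T \<oplus>\<^bsub>Q\<^esub> U = S \<oplus>\<^bsub>Q\<^esub> (T \<oplus>\<^bsub>Q\<^esub> U)"
      using x y z by (simp add: S T U add_quotient M.a_assoc)
  qed (simp add: zero_quotient)
next
  fix c d S assume "S \<in> carrier Q"
  then obtain x where x: "x \<in> carrier V" and S: "S = coset x" by (rule carrier_quotientE)
  show "c \<odot>\<^bsub>Q\<^esub> S \<in> carrier Q"
    using x by (simp add: S smult_quotient)
  show "(c \<oplus>\<^bsub>\<CC>\<^esub> d) \<odot>\<^bsub>Q\<^esub> S = c \<odot>\<^bsub>Q\<^esub> S \<oplus>\<^bsub>Q\<^esub> d \<odot>\<^bsub>Q\<^esub> S"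
    using x smult_l_distr[of c d x] by (simp add: S smult_quotient add_quotient)
  show "(c \<otimes>\<^bsub>\<CC>\<^esub> d) \<odot>\<^bsub>Q\<^esub> S = c \<odot>\<^bsub>Q\<^esub> (d \<odot>\<^bsub>Q\<^esub> S)"
    using x smult_assoc1[of c d x] by (simp add: S smult_quotient)
  show "\<one>\<^bsub>\<CC>\<^esub> \<odot>\<^bsub>Q\<^esub> S = S"
    using x smult_one[of x] by (simp add: S smult_quotient)
  fix T assume "T \<in> carrier Q"
  then obtain y where y: "y \<in> carrier V" and T: "T = coset y" by (rule carrier_quotientE)
  show "c \<odot>\<^bsub>Q\<^esub> (S \<oplus>\<^bsub>Q\<^esub> T) = c \<odot>\<^bsub>Q\<^esub> S \<oplus>\<^bsub>Q\<^esub> c \<odot>\<^bsub>Q\<^esub> T"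
    using x y by (simp add: S T smult_quotient add_quotient smult_r_distr)
qed

lemma normed_module_quotient: "normed_module Q"
proof (intro normed_module.intro normed_module_axioms.intro)
  show "Module.module \<CC> Q" by (rule quotient_module)
  fix S assume "S \<in> carrier Q"
  then obtain x where x: "x \<in> carrier V" and S: "S = coset x" by (rule carrier_quotientE)
  show nonneg: "0 \<le> vnorm Q S"
    using x unfolding S by (intro vnorm_quotient_greatest) (auto simp: vnorm_nonneg)
  show "vnorm Q S = 0 \<longleftrightarrow> S = \<zero>\<^bsub>Q\<^esub>"
  proof
    assume "S = \<zero>\<^bsub>Q\<^esub>"
    then show "vnorm Q S = 0" using nonneg vnorm_quotient_le[of \<zero>] by (simp add: zero_quotient)
  next
    assume 0: "vnorm Q S = 0"
    \<comment> \<open>A coset of norm zero has representatives \<open>y\<close> of arbitrarily small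
      norm. Each gives the element \<open>x \<ominus> y\<close> of \<open>N\<close> at distance
      \<open>vnorm V y\<close> from \<open>x\<close>, so \<open>x\<close> is a limit of points of
      the closed set \<open>N\<close>.\<close>
    have "\<exists>y\<in>N. vnorm V (x \<ominus> y) < \<epsilon>" if \<epsilon>: "\<epsilon> > 0" for \<epsilon>
    proof -
      from vnorm_quotient_approx[OF x] 0 \<epsilon> S
      obtain y where y: "y \<in> carrier V" "coset y = coset x" "vnorm V y < \<epsilon>" by metis
      have "x \<ominus> (x \<ominus> y) = y"
        using x y by (simp add: M.minus_eq M.minus_add M.r_neg2)
      moreover have "x \<ominus> y \<in> N" using x y by (simp flip: coset_eq_iff)
      ultimately show ?thesis using y(3) by metis
    qed
    then have "x \<in> N" using closedin_N x unfolding closedin_iff by blast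
    then show "S = \<zero>\<^bsub>Q\<^esub>" unfolding S zero_quotient
      using x by (simp add: coset_eq_iff M.minus_eq)
  qed
  show "vnorm Q (c \<odot>\<^bsub>Q\<^esub> S) = cmod c * vnorm Q S" for c
  proof (cases "c = 0")
    case True
    have "0 \<le> vnorm Q (coset \<zero>)"
      by (intro vnorm_quotient_greatest) (auto simp: vnorm_nonneg)
    then have "vnorm Q (coset \<zero>) = 0"
      using vnorm_quotient_le[of \<zero>] by simp
    then show ?thesis using x smult_l_null[OF x] by (simp add: True S smult_quotient)
  next
    case False
    \<comment> \<open>This upper bound is used twice: for \<open>c\<close> itself, and for
      \<open>inverse c\<close> acting on the multiple by \<open>c\<close>, which yields the opposite
      inequality.\<close>
    have le: "vnorm Q (d \<odot>\<^bsub>Q\<^esub> coset y) \<le> cmod d * vnorm Q (coset y)"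
      if y: "y \<in> carrier V" and d: "d \<noteq> 0" for d y
    proof -
      have "vnorm Q (d \<odot>\<^bsub>Q\<^esub> coset y) / cmod d \<le> vnorm Q (coset y)"
      proof (rule vnorm_quotient_greatest[OF y])
        fix z assume z: "z \<in> carrier V" "coset z = coset y"
        have "vnorm Q (d \<odot>\<^bsub>Q\<^esub> coset y) \<le> cmod d * vnorm V z"
          using vnorm_quotient_le[of "d \<odot> z"] z smult_quotient[OF z(1)]
          by (simp add: vnorm_smult)
        then show "vnorm Q (d \<odot>\<^bsub>Q\<^esub> coset y) / cmod d \<le> vnorm V z"
          using d by (simp add: field_simps)
      qed
      then show ?thesis using d by (simp add: field_simps)
    qed
    have "inverse c \<odot> (c \<odot> x) = x"
      using smult_assoc1[of "inverse c" c x] smult_one[OF x] x False by simp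
    then have "vnorm Q S \<le> cmod (inverse c) * vnorm Q (c \<odot>\<^bsub>Q\<^esub> S)"
      using le[of "c \<odot> x" "inverse c"] False x by (simp add: S smult_quotient)
    then have "cmod c * vnorm Q S \<le> vnorm Q (c \<odot>\<^bsub>Q\<^esub> S)"
      using False by (simp add: norm_divide field_simps)
    then show ?thesis using le[OF x False] S by simp
  qed
  fix T assume "T \<in> carrier Q"
  then obtain y where y: "y \<in> carrier V" and T: "T = coset y" by (rule carrier_quotientE)
  show "vnorm Q (S \<oplus>\<^bsub>Q\<^esub> T) \<le> vnorm Q S + vnorm Q T"
  proof (rule field_le_epsilon)
    fix \<epsilon> :: real assume \<epsilon>: "\<epsilon> > 0"
    obtain x' where x': "x' \<in> carrier V" "coset x' = coset x" "vnorm V x' < vnorm Q S + \<epsilon>/2"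
      using vnorm_quotient_approx[OF x, of "vnorm Q S + \<epsilon>/2"] \<epsilon> S by auto
    obtain y' where y': "y' \<in> carrier V" "coset y' = coset y" "vnorm V y' < vnorm Q T + \<epsilon>/2"
      using vnorm_quotient_approx[OF y, of "vnorm Q T + \<epsilon>/2"] \<epsilon> T by auto
    have "vnorm Q (S \<oplus>\<^bsub>Q\<^esub> T) = vnorm Q (coset (x' \<oplus> y'))"
      unfolding S T using x' y' by (simp flip: add_quotient)
    also have "\<dots> \<le> vnorm V (x' \<oplus> y')" using x' y' by (simp add: vnorm_quotient_le)
    also have "\<dots> \<le> vnorm V x' + vnorm V y'" using x' y' by (simp add: vnorm_triangle)
    also have "\<dots> \<le> vnorm Q S + vnorm Q T + \<epsilon>" using x'(3) y'(3) by simp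
    finally show "vnorm Q (S \<oplus>\<^bsub>Q\<^esub> T) \<le> vnorm Q S + vnorm Q T + \<epsilon>" .
  qed
qed

lemma coset_map: "bounded_module_map V Q coset 1"
  by (intro bounded_module_map.intro bounded_module_map_axioms.intro normed_module_axioms
      normed_module_quotient) (auto simp: add_quotient smult_quotient vnorm_quotient_le)

text \<open>The coset map is bounded, so \<open>image_closed_span\<close> applies to it: the
  preimage of the closed span of the image is a closed submodule containing \<open>S\<close>, hence
  everything.\<close>

lemma closed_span_quotient:
  assumes "S \<subseteq> carrier V" "closed_span V S = carrier V"
  shows "closed_span Q (coset ` S) = carrier Q"
proof -
  interpret Q: normed_module Q by (rule normed_module_quotient)
  have sub: "coset ` S \<subseteq> carrier Q" using assms(1) by auto
  show ?thesis
  proof (intro subset_antisym Q.closed_span_subset_carrier subsetI)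
    fix Z assume "Z \<in> carrier Q"
    then obtain x where "x \<in> carrier V" "Z = coset x" by (rule carrier_quotientE)
    then show "Z \<in> closed_span Q (coset ` S)"
      using bounded_module_map.image_closed_span[OF coset_map Q.submodule_closed_span[OF sub]
          Q.closedin_closed_span assms(1) Q.closed_span_superset[OF sub]] assms(2) by simp
  qed
qed

end

section \<open>Completeness of the quotient\<close>

locale closed_banach_submodule = complex_banach_space V + closed_submodule V N
  for V :: "'a normed_struct" (structure) and N
begin

text \<open>A subsequence with geometrically decreasing increments lifts to a Cauchy sequence of
  representatives.\<close>

lemma mcomplete_quotient: "Metric_space.mcomplete (carrier Q) (vdist Q)"
proof -
  interpret Q: normed_module Q by (rule normed_module_quotient)
  interpret c: bounded_module_map V Q coset 1 by (rule coset_map)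
  show ?thesis
    unfolding Q.metric.mcomplete_def
  proof (intro allI impI)
    fix \<sigma> assume cau: "Q.metric.MCauchy \<sigma>"
    then have \<sigma>: "\<sigma> n \<in> carrier Q" for n
      unfolding Q.metric.MCauchy_def by blast
    have cau': "\<exists>N. \<forall>n n'. N \<le> n \<longrightarrow> N \<le> n' \<longrightarrow> vdist Q (\<sigma> n) (\<sigma> n') < \<epsilon>" if "\<epsilon> > 0" for \<epsilon>
      using cau that unfolding Q.metric.MCauchy_def by blast
    \<comment> \<open>The index \<open>r n\<close> is a Cauchy threshold for the bound
      \<open>(1/2) ^ n\<close>. The maximum taken in the recursion keeps the threshold property and
      makes \<open>r\<close> strictly increasing.\<close>
    have "\<exists>r. \<forall>n. (\<forall>m m'. r n \<le> m \<longrightarrow> r n \<le> m' \<longrightarrow> vdist Q (\<sigma> m) (\<sigma> m') < (1/2) ^ n)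
        \<and> r n < r (Suc n)"
    proof (rule dependent_nat_choice)
      show "\<exists>k. \<forall>m m'. k \<le> m \<longrightarrow> k \<le> m' \<longrightarrow> vdist Q (\<sigma> m) (\<sigma> m') < (1/2) ^ 0"
        using cau'[of 1] by simp
      fix k n
      obtain K where "\<forall>m m'. K \<le> m \<longrightarrow> K \<le> m' \<longrightarrow> vdist Q (\<sigma> m) (\<sigma> m') < (1/2) ^ Suc n"
        using cau'[of "(1/2) ^ Suc n"] by auto
      then show "\<exists>k'. (\<forall>m m'. k' \<le> m \<longrightarrow> k' \<le> m' \<longrightarrow> vdist Q (\<sigma> m) (\<sigma> m') < (1/2) ^ Suc n)
          \<and> k < k'"
        by (intro exI[of _ "max K (Suc k)"]) auto
    qed
    then obtain r where r: "\<And>n m m'. \<lbrakk>r n \<le> m; r n \<le> m'\<rbrakk> \<Longrightarrow> vdist Q (\<sigma> m) (\<sigma> m') < (1/2) ^ n"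
      and mono: "strict_mono r"
      unfolding strict_mono_Suc_iff by blast
    have "\<exists>x. \<forall>n. (x n \<in> carrier V \<and> coset (x n) = \<sigma> (r n))
        \<and> vnorm V (x n \<ominus> x (Suc n)) < (1/2) ^ n"
    proof (rule dependent_nat_choice)
      show "\<exists>x. x \<in> carrier V \<and> coset x = \<sigma> (r 0)"
        using \<sigma> by (metis carrier_quotientE)
      fix x n assume x: "x \<in> carrier V \<and> coset x = \<sigma> (r n)"
      obtain y where y: "y \<in> carrier V" "coset y = \<sigma> (r (Suc n))"
        using \<sigma> by (metis carrier_quotientE)
      have "vnorm Q (coset (x \<ominus> y)) = vdist Q (\<sigma> (r n)) (\<sigma> (r (Suc n)))"
        using x y \<sigma> by (simp add: c.map_minus vdist_def)
      also have "\<dots> < (1/2) ^ n"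
        using mono by (intro r) (auto simp: strict_mono_less_eq)
      \<comment> \<open>\<open>z\<close> is a small representative of the difference of two
        consecutive cosets. The next lift is \<open>x \<ominus> z\<close>: it lies in the coset of
        \<open>y\<close>, at distance \<open>vnorm V z\<close> from \<open>x\<close>.\<close>
      finally obtain z where z: "z \<in> carrier V" "coset z = coset (x \<ominus> y)" "vnorm V z < (1/2) ^ n"
        using vnorm_quotient_approx[of "x \<ominus> y"] x y by auto
      have xz: "x \<ominus> (x \<ominus> z) = z" if "z \<in> carrier V" for z
        using that x by (simp add: M.minus_eq M.minus_add M.r_neg2)
      have "coset (x \<ominus> z) = coset (x \<ominus> (x \<ominus> y))"
        using x y(1) z(1,2) by (simp add: c.map_minus)
      then show "\<exists>w. (w \<in> carrier V \<and> coset w = \<sigma> (r (Suc n))) \<and> vnorm V (x \<ominus> w) < (1/2) ^ n"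
        using x y z xz by (intro exI[of _ "x \<ominus> z"]) simp
    qed
    then obtain x where xV: "\<And>n. x n \<in> carrier V" and xr: "\<And>n. coset (x n) = \<sigma> (r n)"
      and step: "\<And>n. vnorm V (x n \<ominus> x (Suc n)) < (1/2) ^ n"
      by blast
    \<comment> \<open>The right side is the exact value of the partial geometric sum. The subtracted
      term is what lets the induction absorb each new increment.\<close>
    have tail: "vnorm V (x n \<ominus> x (n + k)) \<le> 2 * (1/2) ^ n - 2 * (1/2) ^ (n + k)" for n k
    proof (induction k)
      case 0
      show ?case using xV[of n] by (simp add: M.minus_eq M.r_neg)
    next
      case (Suc k)
      show ?case
        using vnorm_minus_triangle[of "x n" "x (n + k)" "x (n + Suc k)"] step[of "n + k"] Suc xV
        by simp
    qed
    have bound: "vdist V (x n) (x m) \<le> 2 * (1/2) ^ n" if "n \<le> m" for n m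
    proof -
      have "vdist V (x n) (x m) \<le> 2 * (1/2) ^ n - 2 * (1/2) ^ m"
        using tail[of n "m - n"] that xV by (simp add: vdist_def)
      then show ?thesis using zero_le_power[of "1/2::real" m] by linarith
    qed
    have "metric.MCauchy x"
      unfolding metric.MCauchy_def
    proof (intro conjI allI impI)
      show "range x \<subseteq> carrier V" using xV by auto
      fix \<epsilon> :: real assume \<epsilon>: "\<epsilon> > 0"
      obtain K where K: "(1/2::real) ^ K < \<epsilon> / 2"
        using real_arch_pow_inv[of "\<epsilon>/2" "1/2"] \<epsilon> by auto
      have "vdist V (x n) (x m) < \<epsilon>" if "K \<le> n" "n \<le> m" for n m
      proof -
        have "(1/2::real) ^ n \<le> (1/2) ^ K" using that by (simp add: power_decreasing)
        then show ?thesis using bound[OF that(2)] K by linarith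
      qed
      then show "\<exists>K. \<forall>n n'. K \<le> n \<longrightarrow> K \<le> n' \<longrightarrow> vdist V (x n) (x n') < \<epsilon>"
        by (metis metric.commute nle_le)
    qed
    then obtain l where l: "limitin (norm_topology V) x l sequentially"
      using complete unfolding metric.mcomplete_def by blast
    then have lV: "l \<in> carrier V" unfolding metric.limit_metric_sequentially by blast
    have "limitin (norm_topology Q) (\<sigma> \<circ> r) (coset l) sequentially"
      unfolding Q.metric.limit_metric_sequentially
    proof (intro conjI allI impI)
      show "coset l \<in> carrier Q" using lV by simp
      fix \<epsilon> :: real assume "\<epsilon> > 0"
      then obtain K where K: "\<And>n. n \<ge> K \<Longrightarrow> vdist V (x n) l < \<epsilon>"
        using l unfolding metric.limit_metric_sequentially by blast
      have "vdist Q (coset (x n)) (coset l) \<le> vdist V (x n) l" for n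
        using c.map_bounded[of "x n \<ominus> l"] xV lV by (simp add: vdist_def c.map_minus)
      then show "\<exists>K. \<forall>n\<ge>K. (\<sigma> \<circ> r) n \<in> carrier Q \<and> vdist Q ((\<sigma> \<circ> r) n) (coset l) < \<epsilon>"
        using K \<sigma> by (metis comp_apply order_le_less_trans xr)
    qed
    \<comment> \<open>The coset map is contractive, so the chosen subsequence converges to the coset
      of \<open>l\<close>, and a Cauchy sequence with a convergent subsequence converges.\<close>
    then show "\<exists>Z. limitin (norm_topology Q) \<sigma> Z sequentially"
      using Q.metric.MCauchy_convergent_subsequence[OF cau mono] by blast
  qed
qed

lemma banach_quotient: "complex_banach_space Q"
  by (simp add: complex_banach_space_iff normed_module_quotient mcomplete_quotient)

end

section \<open>Bilinear maps between quotients\<close>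

text \<open>The two absorption conditions say that the class of \<open>p x y\<close> modulo
  \<open>N\<close> depends only on the classes of \<open>x\<close> and \<open>y\<close>.
  Multiplications, module actions and pairings are all treated as instances.\<close>

locale bilinear_quotient =
  U: closed_submodule U K + V: closed_submodule V L + W: closed_submodule W N
  for U :: "'a normed_struct" and V :: "'b normed_struct" and W :: "'c normed_struct"
    and K L N and p :: "'a \<Rightarrow> 'b \<Rightarrow> 'c" +
  assumes bilinear: "contractive_bilinear U V W p"
    and absorb_left: "\<lbrakk>x \<in> K; y \<in> carrier V\<rbrakk> \<Longrightarrow> p x y \<in> N"
    and absorb_right: "\<lbrakk>x \<in> carrier U; y \<in> L\<rbrakk> \<Longrightarrow> p x y \<in> N"
begin

lemma closed [simp]: "\<lbrakk>x \<in> carrier U; y \<in> carrier V\<rbrakk> \<Longrightarrow> p x y \<in> carrier W"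
  using bilinear by (simp add: contractive_bilinear_def)

text \<open>The representatives are exchanged one at a time: first \<open>x'\<close> for
  \<open>x\<close> with \<open>y'\<close> fixed, by \<open>absorb_left\<close>, then
  \<open>y'\<close> for \<open>y\<close>, by \<open>absorb_right\<close>. The union in
  \<open>induced_map\<close> therefore consists of copies of a single coset.\<close>

lemma induced_map_coset:
  assumes x: "x \<in> carrier U" and y: "y \<in> carrier V"
  shows "induced_map W N p (U.coset x) (V.coset y) = W.coset (p x y)"
proof -
  have eq: "W.coset (p x' y') = W.coset (p x y)" if "x' \<in> U.coset x" "y' \<in> V.coset y" for x' y'
  proof -
    have x': "x' \<in> carrier U" "x' \<ominus>\<^bsub>U\<^esub> x \<in> K"
      using that(1) x U.mem_coset_iff U.coset_eq_iff by auto
    have y': "y' \<in> carrier V" "y' \<ominus>\<^bsub>V\<^esub> y \<in> L"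
      using that(2) y V.mem_coset_iff V.coset_eq_iff by auto
    interpret l: bounded_module_map U W "\<lambda>x. p x y'" "vnorm V y'"
      by (rule contractive_bilinear_left_map[OF bilinear U.normed_module_axioms
            W.normed_module_axioms y'(1)])
    interpret r: bounded_module_map V W "p x" "vnorm U x"
      by (rule contractive_bilinear_right_map[OF bilinear V.normed_module_axioms
            W.normed_module_axioms x])
    have "W.coset (p x' y') = W.coset (p x y')"
      using absorb_left[OF x'(2) y'(1)] x x' y' by (simp add: W.coset_eq_iff l.map_minus)
    also have "\<dots> = W.coset (p x y)"
      using absorb_right[OF x y'(2)] x y y' by (simp add: W.coset_eq_iff r.map_minus)
    finally show ?thesis .
  qed
  have ne: "U.coset x \<noteq> {}" "V.coset y \<noteq> {}"
    using U.N.a_rcos_self[OF x] V.N.a_rcos_self[OF y] by auto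
  have "(\<Union>y'\<in>V.coset y. W.coset (p x' y')) = W.coset (p x y)" if "x' \<in> U.coset x" for x'
    using that eq by (intro SUP_eq_const[OF ne(2)])
  then show ?thesis
    unfolding induced_map_def by (rule SUP_eq_const[OF ne(1)])
qed

lemma induced_map_bilinear: "contractive_bilinear U.Q V.Q W.Q (induced_map W N p)"
  unfolding contractive_bilinear_def
proof (intro conjI ballI allI)
  fix S T assume "S \<in> carrier U.Q" "T \<in> carrier V.Q"
  then obtain x y where x: "x \<in> carrier U" and S: "S = U.coset x"
    and y: "y \<in> carrier V" and T: "T = V.coset y"
    by (metis U.carrier_quotientE V.carrier_quotientE)
  show "induced_map W N p S T \<in> carrier W.Q"
    using x y by (simp add: S T induced_map_coset)
  interpret UQ: normed_module U.Q by (rule U.normed_module_quotient)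
  interpret VQ: normed_module V.Q by (rule V.normed_module_quotient)
  \<comment> \<open>Since quotient norms need not be attained, both factors are enlarged by
    \<epsilon>. Letting \<epsilon> tend to zero from the right recovers the contractive
    bound.\<close>
  have le: "vnorm W.Q (induced_map W N p S T) \<le> (vnorm U.Q S + \<epsilon>) * (vnorm V.Q T + \<epsilon>)"
    if \<epsilon>: "\<epsilon> > 0" for \<epsilon> :: real
  proof -
    obtain x' where x': "x' \<in> carrier U" "U.coset x' = U.coset x" "vnorm U x' < vnorm U.Q S + \<epsilon>"
      using U.vnorm_quotient_approx[OF x, of "vnorm U.Q S + \<epsilon>"] \<epsilon> S by auto
    obtain y' where y': "y' \<in> carrier V" "V.coset y' = V.coset y" "vnorm V y' < vnorm V.Q T + \<epsilon>"
      using V.vnorm_quotient_approx[OF y, of "vnorm V.Q T + \<epsilon>"] \<epsilon> T by auto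
    have "induced_map W N p S T = W.coset (p x' y')"
      using induced_map_coset[OF x'(1) y'(1)] by (simp add: S T x'(2) y'(2))
    then have "vnorm W.Q (induced_map W N p S T) \<le> vnorm W (p x' y')"
      using x'(1) y'(1) by (simp add: W.vnorm_quotient_le)
    also have "\<dots> \<le> vnorm U x' * vnorm V y'"
      using bilinear x'(1) y'(1) by (simp add: contractive_bilinear_def)
    also have "\<dots> \<le> (vnorm U.Q S + \<epsilon>) * (vnorm V.Q T + \<epsilon>)"
      using x' y' U.vnorm_nonneg[OF x'(1)] V.vnorm_nonneg[OF y'(1)] by (intro mult_mono) auto
    finally show ?thesis .
  qed
  have "((\<lambda>\<epsilon>. (vnorm U.Q S + \<epsilon>) * (vnorm V.Q T + \<epsilon>)) \<longlongrightarrow> vnorm U.Q S * vnorm V.Q T)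
      (at_right 0)"
    by (auto intro!: tendsto_eq_intros)
  moreover have "\<forall>\<^sub>F \<epsilon> in at_right (0::real).
      vnorm W.Q (induced_map W N p S T) \<le> (vnorm U.Q S + \<epsilon>) * (vnorm V.Q T + \<epsilon>)"
    using eventually_at_right_less by (rule eventually_mono) (rule le)
  ultimately show "vnorm W.Q (induced_map W N p S T) \<le> vnorm U.Q S * vnorm V.Q T"
    by (intro tendsto_lowerbound) auto
next
  fix S S' T assume "S \<in> carrier U.Q" "S' \<in> carrier U.Q" "T \<in> carrier V.Q"
  then obtain x x' y where "x \<in> carrier U" "S = U.coset x" "x' \<in> carrier U" "S' = U.coset x'"
    "y \<in> carrier V" "T = V.coset y"
    by (metis U.carrier_quotientE V.carrier_quotientE)
  then show "induced_map W N p (S \<oplus>\<^bsub>U.Q\<^esub> S') T =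
      induced_map W N p S T \<oplus>\<^bsub>W.Q\<^esub> induced_map W N p S' T"
    using bilinear
    by (simp add: U.add_quotient W.add_quotient induced_map_coset contractive_bilinear_def)
next
  fix S T T' assume "S \<in> carrier U.Q" "T \<in> carrier V.Q" "T' \<in> carrier V.Q"
  then obtain x y y' where "x \<in> carrier U" "S = U.coset x" "y' \<in> carrier V" "T' = V.coset y'"
    "y \<in> carrier V" "T = V.coset y"
    by (metis U.carrier_quotientE V.carrier_quotientE)
  then show "induced_map W N p S (T \<oplus>\<^bsub>V.Q\<^esub> T') =
      induced_map W N p S T \<oplus>\<^bsub>W.Q\<^esub> induced_map W N p S T'"
    using bilinear
    by (simp add: V.add_quotient W.add_quotient induced_map_coset contractive_bilinear_def)
next
  fix c S T assume "S \<in> carrier U.Q" "T \<in> carrier V.Q"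
  then obtain x y where "x \<in> carrier U" "S = U.coset x" "y \<in> carrier V" "T = V.coset y"
    by (metis U.carrier_quotientE V.carrier_quotientE)
  then show "induced_map W N p (c \<odot>\<^bsub>U.Q\<^esub> S) T = c \<odot>\<^bsub>W.Q\<^esub> induced_map W N p S T"
    and "induced_map W N p S (c \<odot>\<^bsub>V.Q\<^esub> T) = c \<odot>\<^bsub>W.Q\<^esub> induced_map W N p S T"
    using bilinear U.smult_closed[of c x] V.smult_closed[of c y]
    by (simp_all add: U.smult_quotient V.smult_quotient W.smult_quotient induced_map_coset
        contractive_bilinear_def)
qed

text \<open>The values of the induced map are exactly the cosets of the values of \<open>p\<close>,
  so \<open>closed_span_quotient\<close> applies. Both fullness of pairings and nondegeneracy of
  actions have this form.\<close>

lemma induced_map_full: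
  assumes "closed_span W {p x y | x y. x \<in> carrier U \<and> y \<in> carrier V} = carrier W"
  shows "closed_span W.Q {induced_map W N p S T | S T. S \<in> carrier U.Q \<and> T \<in> carrier V.Q}
    = carrier W.Q"
proof -
  have "{induced_map W N p S T | S T. S \<in> carrier U.Q \<and> T \<in> carrier V.Q}
      = W.coset ` {p x y | x y. x \<in> carrier U \<and> y \<in> carrier V}"
    unfolding U.carrier_quotient V.carrier_quotient
    by (auto simp: image_iff induced_map_coset) (metis induced_map_coset)+
  then show ?thesis
    using W.closed_span_quotient[OF _ assms] by fastforce
qed

end

section \<open>Annihilators modulo a submodule, quotient algebras and quotient bimodules\<close>

text \<open>Through this symmetry the annihilator lemma below covers \<open>left_part\<close> as
  well as \<open>right_part\<close>.\<close>

lemma contractive_bilinear_flip: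
  "contractive_bilinear U V W p \<Longrightarrow> contractive_bilinear V U W (\<lambda>y x. p x y)"
  by (simp add: contractive_bilinear_def mult.commute)

text \<open>The set is an intersection of preimages of \<open>H\<close> under the bounded maps
  \<open>p x\<close>, and each preimage is a closed submodule.\<close>

lemma closed_submodule_annihilator:
  assumes "contractive_bilinear U V W p" "normed_module U" "normed_module V" "closed_submodule W H"
  shows "closed_submodule V {y \<in> carrier V. \<forall>x\<in>carrier U. p x y \<in> H}"
proof -
  interpret U: normed_module U by fact
  interpret V: normed_module V by fact
  interpret W: closed_submodule W H by fact
  let ?H = "\<lambda>x. {y \<in> carrier V. p x y \<in> H}"
  have map: "bounded_module_map V W (p x) (vnorm U x)" if "x \<in> carrier U" for x
    using contractive_bilinear_right_map[OF assms(1,3) W.normed_module_axioms that] .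
  have sub: "submodule (?H x) \<CC> V" and closed: "closedin (norm_topology V) (?H x)"
    if "x \<in> carrier U" for x
    using bounded_module_map.submodule_vimage[OF map[OF that] W.submodule_N]
      bounded_module_map.closedin_vimage[OF map[OF that] W.closedin_N] .
  \<comment> \<open>The zero of \<open>U\<close> makes the index set nonempty, which keeps the
    intersection inside the carrier of \<open>V\<close>.\<close>
  have eq: "{y \<in> carrier V. \<forall>x\<in>carrier U. p x y \<in> H} = (\<Inter>x\<in>carrier U. ?H x)"
    using U.M.zero_closed by blast
  show ?thesis
    unfolding eq
  proof (intro closed_submodule.intro closed_submodule_axioms.intro V.normed_module_axioms)
    show "closedin (norm_topology V) (\<Inter>x\<in>carrier U. ?H x)"
      using closed U.M.zero_closed by (intro closedin_Inter) auto
    show "submodule (\<Inter>x\<in>carrier U. ?H x) \<CC> V"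
    proof (rule V.submoduleI)
      show "(\<Inter>x\<in>carrier U. ?H x) \<subseteq> carrier V"
        using U.M.zero_closed by blast
      show "\<zero>\<^bsub>V\<^esub> \<in> (\<Inter>x\<in>carrier U. ?H x)"
        using subgroup.one_closed[OF submodule.axioms(1)[OF sub]] by fastforce
      show "\<ominus>\<^bsub>V\<^esub> a \<in> (\<Inter>x\<in>carrier U. ?H x)" if "a \<in> (\<Inter>x\<in>carrier U. ?H x)" for a
        using that V.submoduleE(3)[OF sub] by blast
      show "a \<oplus>\<^bsub>V\<^esub> b \<in> (\<Inter>x\<in>carrier U. ?H x)"
        if "a \<in> (\<Inter>x\<in>carrier U. ?H x)" "b \<in> (\<Inter>x\<in>carrier U. ?H x)" for a b
        using that V.submoduleE(5)[OF sub] by blast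
      show "c \<odot>\<^bsub>V\<^esub> a \<in> (\<Inter>x\<in>carrier U. ?H x)"
        if "c \<in> carrier \<CC>" "a \<in> (\<Inter>x\<in>carrier U. ?H x)" for c a
        using that V.submoduleE(4)[OF sub] by blast
    qed
  qed
qed

lemma (in banach_algebra) closed_ideal_iff:
  "closed_ideal A I \<longleftrightarrow> closed_banach_submodule A I \<and>
    (\<forall>a\<in>carrier A. \<forall>x\<in>I. a \<otimes> x \<in> I \<and> x \<otimes> a \<in> I)"
  by (auto simp: closed_ideal_def closed_banach_submodule_def closed_submodule_def
      closed_submodule_axioms_def complex_banach_space_axioms normed_module_axioms)

text \<open>This makes the product of a quotient algebra an induced bilinear map, so that the
  results on \<open>bilinear_quotient\<close> apply to it.\<close>

lemma mult_quotient: "mult (quotient_struct A I) = induced_map A I (mult A)"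
  by (simp add: quotient_struct_def rcoset_mult_def induced_map_def fun_eq_iff)

lemma (in banach_algebra) bilinear_quotient_mult:
  assumes "closed_ideal A I"
  shows "bilinear_quotient A A A I I I (mult A)"
  using assms mult_bilinear
  by (simp add: closed_ideal_iff bilinear_quotient_def bilinear_quotient_axioms_def
      closed_banach_submodule_def)

lemma (in banach_algebra) banach_algebra_quotient:
  assumes "closed_ideal A I"
  shows "banach_algebra (quotient_struct A I)"
proof -
  interpret q: closed_banach_submodule A I
    using assms by (simp add: closed_ideal_iff)
  interpret m: bilinear_quotient A A A I I I "mult A"
    by (rule bilinear_quotient_mult[OF assms])
  show ?thesis
  proof (intro banach_algebra.intro banach_algebra_axioms.intro q.banach_quotient)
    show "contractive_bilinear q.Q q.Q q.Q (\<lambda>S T. S \<otimes>\<^bsub>q.Q\<^esub> T)"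
      using m.induced_map_bilinear by (simp add: mult_quotient)
    fix S T Z assume "S \<in> carrier q.Q" "T \<in> carrier q.Q" "Z \<in> carrier q.Q"
    then obtain x y z where "x \<in> carrier A" "S = q.coset x" "y \<in> carrier A" "T = q.coset y"
      "z \<in> carrier A" "Z = q.coset z"
      by (metis q.carrier_quotientE)
    then show "(S \<otimes>\<^bsub>q.Q\<^esub> T) \<otimes>\<^bsub>q.Q\<^esub> Z = S \<otimes>\<^bsub>q.Q\<^esub> (T \<otimes>\<^bsub>q.Q\<^esub> Z)"
      by (simp add: mult_quotient m.induced_map_coset mult_assoc)
  qed
qed

text \<open>Evaluated on representatives, each associativity law of the quotient becomes the coset
  of the original law.\<close>

lemma (in banach_bimodule) banach_bimodule_quotient:
  assumes "closed_ideal L K" "closed_ideal R H" "closed_banach_submodule E N"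
    and "bilinear_quotient L E E K N N l" "bilinear_quotient E R E N H N r"
  shows "banach_bimodule (quotient_struct L K) (quotient_struct R H) (quotient_struct E N)
    (induced_map E N l) (induced_map E N r)"
proof -
  interpret N: closed_banach_submodule E N by fact
  interpret l: bilinear_quotient L E E K N N l by fact
  interpret r: bilinear_quotient E R E N H N r by fact
  interpret L': bilinear_quotient L L L K K K "mult L"
    by (rule L.bilinear_quotient_mult[OF assms(1)])
  interpret R': bilinear_quotient R R R H H H "mult R"
    by (rule R.bilinear_quotient_mult[OF assms(2)])
  show ?thesis
  proof (intro banach_bimodule.intro banach_bimodule_axioms.intro N.banach_quotient
      L.banach_algebra_quotient R.banach_algebra_quotient assms(1,2)
      l.induced_map_bilinear r.induced_map_bilinear)
    fix S assume "S \<in> carrier N.Q"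
    then obtain x where x: "x \<in> carrier E" "S = N.coset x" by (rule N.carrier_quotientE)
    show "induced_map E N l (T \<otimes>\<^bsub>l.U.Q\<^esub> T') S = induced_map E N l T (induced_map E N l T' S)"
      if TT': "T \<in> carrier l.U.Q" "T' \<in> carrier l.U.Q" for T T'
    proof -
      obtain a a' where "a \<in> carrier L" "T = l.U.coset a" "a' \<in> carrier L" "T' = l.U.coset a'"
        using TT' by (metis l.U.carrier_quotientE)
      then show ?thesis
        using x by (simp add: mult_quotient L'.induced_map_coset l.induced_map_coset left_assoc)
    qed
    show "induced_map E N r S (T \<otimes>\<^bsub>r.V.Q\<^esub> T') = induced_map E N r (induced_map E N r S T) T'"
      if TT': "T \<in> carrier r.V.Q" "T' \<in> carrier r.V.Q" for T T'
    proof -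
      obtain b b' where "b \<in> carrier R" "T = r.V.coset b" "b' \<in> carrier R" "T' = r.V.coset b'"
        using TT' by (metis r.V.carrier_quotientE)
      then show ?thesis
        using x by (simp add: mult_quotient R'.induced_map_coset r.induced_map_coset right_assoc)
    qed
    show "induced_map E N r (induced_map E N l T S) T' = induced_map E N l T (induced_map E N r S T')"
      if TT': "T \<in> carrier l.U.Q" "T' \<in> carrier r.V.Q" for T T'
    proof -
      obtain a b where "a \<in> carrier L" "T = l.U.coset a" "b \<in> carrier R" "T' = r.V.coset b"
        using TT' by (metis l.U.carrier_quotientE r.V.carrier_quotientE)
      then show ?thesis
        using x by (simp add: l.induced_map_coset r.induced_map_coset left_right)
    qed
  qed
qed

section \<open>The submodules and the induced ideal of a Morita equivalence\<close>

text \<open>The assumption \<open>right_approximate_unit\<close> is what the bounded approximate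
  identity of \<open>A\<close> contributes, stated elementwise so that the net and its index type do
  not enter the locale.\<close>

locale morita_ideal = morita_equivalence +
  fixes I
  assumes closed_ideal_I: "closed_ideal B I"
    and right_approximate_unit:
      "\<lbrakk>a \<in> carrier A; \<epsilon> > 0\<rbrakk> \<Longrightarrow> \<exists>u\<in>carrier A. vnorm A (a \<otimes>\<^bsub>A\<^esub> u \<ominus>\<^bsub>A\<^esub> a) < \<epsilon>"
begin

abbreviation "Nr \<equiv> right_part El Er pB I"
abbreviation "Nl \<equiv> left_part El Er pB I"
abbreviation "J \<equiv> induced_ideal A El Er pB pA I"

sublocale I: closed_banach_submodule B I
  using closed_ideal_I by (simp add: El.L.closed_ideal_iff)

lemma absorb_I: "\<lbrakk>b \<in> carrier B; x \<in> I\<rbrakk> \<Longrightarrow> b \<otimes>\<^bsub>B\<^esub> x \<in> I \<and> x \<otimes>\<^bsub>B\<^esub> b \<in> I"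
  using closed_ideal_I by (simp add: El.L.closed_ideal_iff)

lemma action_closed [simp]:
  "\<lbrakk>b \<in> carrier B; e \<in> carrier El\<rbrakk> \<Longrightarrow> bl b e \<in> carrier El"
  "\<lbrakk>e \<in> carrier El; a \<in> carrier A\<rbrakk> \<Longrightarrow> la e a \<in> carrier El"
  "\<lbrakk>a \<in> carrier A; x \<in> carrier Er\<rbrakk> \<Longrightarrow> ar a x \<in> carrier Er"
  "\<lbrakk>x \<in> carrier Er; b \<in> carrier B\<rbrakk> \<Longrightarrow> rb x b \<in> carrier Er"
  "\<lbrakk>e \<in> carrier El; x \<in> carrier Er\<rbrakk> \<Longrightarrow> pB e x \<in> carrier B"
  "\<lbrakk>x \<in> carrier Er; e \<in> carrier El\<rbrakk> \<Longrightarrow> pA x e \<in> carrier A"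
  using El.left_bilinear El.right_bilinear Er.left_bilinear Er.right_bilinear
    pB_bilinear pA_bilinear by (simp_all add: contractive_bilinear_def)

lemma mult_closed [simp]:
  "\<lbrakk>b \<in> carrier B; b' \<in> carrier B\<rbrakk> \<Longrightarrow> b \<otimes>\<^bsub>B\<^esub> b' \<in> carrier B"
  "\<lbrakk>a \<in> carrier A; a' \<in> carrier A\<rbrakk> \<Longrightarrow> a \<otimes>\<^bsub>A\<^esub> a' \<in> carrier A"
  using El.L.mult_bilinear El.R.mult_bilinear by (simp_all add: contractive_bilinear_def)

lemma Nr_subset: "x \<in> Nr \<Longrightarrow> x \<in> carrier Er"
  and Nl_subset: "e \<in> Nl \<Longrightarrow> e \<in> carrier El"
  by (simp_all add: right_part_def left_part_def)

lemma pB_Nr: "\<lbrakk>e \<in> carrier El; x \<in> Nr\<rbrakk> \<Longrightarrow> pB e x \<in> I"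
  and pB_Nl: "\<lbrakk>e \<in> Nl; x \<in> carrier Er\<rbrakk> \<Longrightarrow> pB e x \<in> I"
  by (simp_all add: right_part_def left_part_def)

lemma NrI: "\<lbrakk>x \<in> carrier Er; \<And>e. e \<in> carrier El \<Longrightarrow> pB e x \<in> I\<rbrakk> \<Longrightarrow> x \<in> Nr"
  and NlI: "\<lbrakk>e \<in> carrier El; \<And>x. x \<in> carrier Er \<Longrightarrow> pB e x \<in> I\<rbrakk> \<Longrightarrow> e \<in> Nl"
  by (simp_all add: right_part_def left_part_def)

sublocale Nr: closed_banach_submodule Er Nr
  using closed_submodule_annihilator[OF pB_bilinear El.E.normed_module_axioms
      Er.E.normed_module_axioms I.closed_submodule_axioms]
  by (simp add: closed_banach_submodule_def right_part_def Er.E.complex_banach_space_axioms)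

sublocale Nl: closed_banach_submodule El Nl
  using closed_submodule_annihilator[OF contractive_bilinear_flip[OF pB_bilinear]
      Er.E.normed_module_axioms El.E.normed_module_axioms I.closed_submodule_axioms]
  by (simp add: closed_banach_submodule_def left_part_def El.E.complex_banach_space_axioms)

abbreviation "J_generators \<equiv> {pA x e | x e. x \<in> Nr \<and> e \<in> carrier El}"

lemma J_generators_subset: "J_generators \<subseteq> carrier A"
  by (auto dest: Nr_subset)

sublocale J: closed_banach_submodule A J
  unfolding induced_ideal_def
  by (intro closed_banach_submodule.intro closed_submodule.intro closed_submodule_axioms.intro
      El.R.complex_banach_space_axioms El.R.normed_module_axioms El.R.submodule_closed_span
      El.R.closedin_closed_span J_generators_subset)

lemma pA_Nr: "\<lbrakk>x \<in> Nr; e \<in> carrier El\<rbrakk> \<Longrightarrow> pA x e \<in> J"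
  unfolding induced_ideal_def using El.R.closed_span_superset[OF J_generators_subset] by blast

text \<open>Under \<open>pB\<close> the actions of \<open>B\<close> become multiplications, which
  the ideal \<open>I\<close> absorbs. For \<open>la_Nl\<close>, balancing moves \<open>a\<close> to
  the other argument, which is arbitrary in the definition of \<open>Nl\<close>.\<close>

lemma bl_I: "\<lbrakk>b \<in> I; e \<in> carrier El\<rbrakk> \<Longrightarrow> bl b e \<in> Nl"
  and bl_Nl: "\<lbrakk>b \<in> carrier B; e \<in> Nl\<rbrakk> \<Longrightarrow> bl b e \<in> Nl"
  and la_Nl: "\<lbrakk>e \<in> Nl; a \<in> carrier A\<rbrakk> \<Longrightarrow> la e a \<in> Nl"
  and rb_Nr: "\<lbrakk>x \<in> Nr; b \<in> carrier B\<rbrakk> \<Longrightarrow> rb x b \<in> Nr"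
  and rb_I: "\<lbrakk>x \<in> carrier Er; b \<in> I\<rbrakk> \<Longrightarrow> rb x b \<in> Nr"
  by (auto intro!: NrI NlI simp: pB_left pB_right pB_balanced absorb_I pB_Nr pB_Nl)

lemma ar_Nr: "\<lbrakk>a \<in> carrier A; x \<in> Nr\<rbrakk> \<Longrightarrow> ar a x \<in> Nr"
  by (auto intro!: NrI simp: pB_Nr simp flip: pB_balanced)

text \<open>On a generator, compatibility rewrites \<open>la e (pA x f)\<close> as
  \<open>bl (pB e x) f\<close>, where \<open>pB e x\<close> lies in \<open>I\<close> because
  \<open>x\<close> is in \<open>Nr\<close>. The closed span follows since \<open>Nl\<close> is a
  closed submodule.\<close>

lemma la_J:
  assumes e: "e \<in> carrier El" and a: "a \<in> J"
  shows "la e a \<in> Nl"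
proof -
  interpret bounded_module_map A El "la e" "vnorm El e"
    by (rule contractive_bilinear_right_map[OF El.right_bilinear El.R.normed_module_axioms
          El.E.normed_module_axioms e])
  have "la e ` J_generators \<subseteq> Nl"
  proof clarify
    fix x f assume "x \<in> Nr" "f \<in> carrier El"
    then show "la e (pA x f) \<in> Nl"
      using e compatible_left[of e x f] bl_I[OF pB_Nr] Nr_subset by metis
  qed
  then show ?thesis
    using image_closed_span[OF Nl.submodule_N Nl.closedin_N J_generators_subset] a
    by (simp add: induced_ideal_def)
qed

text \<open>Here compatibility turns \<open>ar (pA x f) y\<close> into \<open>rb x (pB f y)\<close>,
  and \<open>Nr\<close> is stable under the action of \<open>B\<close>.\<close>

lemma ar_J:
  assumes a: "a \<in> J" and y: "y \<in> carrier Er"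
  shows "ar a y \<in> Nr"
proof -
  interpret bounded_module_map A Er "\<lambda>a. ar a y" "vnorm Er y"
    by (rule contractive_bilinear_left_map[OF Er.left_bilinear El.R.normed_module_axioms
          Er.E.normed_module_axioms y])
  have "(\<lambda>a. ar a y) ` J_generators \<subseteq> Nr"
  proof clarify
    fix x f assume "x \<in> Nr" "f \<in> carrier El"
    then show "ar (pA x f) y \<in> Nr"
      using y compatible_right[of x f y] rb_Nr[of x "pB f y"] Nr_subset by simp
  qed
  then show ?thesis
    using image_closed_span[OF Nr.submodule_N Nr.closedin_N J_generators_subset] a
    by (simp add: induced_ideal_def)
qed

text \<open>A factor from \<open>A\<close> can be moved into a generator: on the left it acts on
  \<open>x\<close>, which stays in \<open>Nr\<close>, and on the right it acts on \<open>e\<close>,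
  which is arbitrary. Continuity of multiplication extends this to the closed span.\<close>

lemma closed_ideal_J: "closed_ideal A J"
  unfolding El.R.closed_ideal_iff
proof (intro conjI ballI J.closed_banach_submodule_axioms)
  fix a x assume a: "a \<in> carrier A" and x: "x \<in> J"
  interpret l: bounded_module_map A A "\<lambda>x. x \<otimes>\<^bsub>A\<^esub> a" "vnorm A a"
    by (rule contractive_bilinear_left_map[OF El.R.mult_bilinear El.R.normed_module_axioms
          El.R.normed_module_axioms a])
  interpret r: bounded_module_map A A "\<lambda>x. a \<otimes>\<^bsub>A\<^esub> x" "vnorm A a"
    by (rule contractive_bilinear_right_map[OF El.R.mult_bilinear El.R.normed_module_axioms
          El.R.normed_module_axioms a])
  have "(\<lambda>x. a \<otimes>\<^bsub>A\<^esub> x) ` J_generators \<subseteq> J"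
  proof clarify
    fix x e assume "x \<in> Nr" "e \<in> carrier El"
    then show "a \<otimes>\<^bsub>A\<^esub> pA x e \<in> J"
      using a pA_left[of a x e] pA_Nr[of "ar a x" e] ar_Nr Nr_subset by simp
  qed
  then show "a \<otimes>\<^bsub>A\<^esub> x \<in> J"
    using r.image_closed_span[OF J.submodule_N J.closedin_N J_generators_subset] x
    by (simp add: induced_ideal_def)
  have "(\<lambda>x. x \<otimes>\<^bsub>A\<^esub> a) ` J_generators \<subseteq> J"
  proof clarify
    fix x e assume "x \<in> Nr" "e \<in> carrier El"
    then show "pA x e \<otimes>\<^bsub>A\<^esub> a \<in> J"
      using a pA_right[of x e a] pA_Nr[of x "la e a"] Nr_subset by simp
  qed
  then show "x \<otimes>\<^bsub>A\<^esub> a \<in> J"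
    using l.image_closed_span[OF J.submodule_N J.closedin_N J_generators_subset] x
    by (simp add: induced_ideal_def)
qed

lemma pA_Nl:
  assumes x: "x \<in> carrier Er" and e: "e \<in> Nl"
  shows "pA x e \<in> J"
proof -
  let ?S = "{pA x e | x e. x \<in> carrier Er \<and> e \<in> carrier El}"
  have e': "e \<in> carrier El" using e by (rule Nl_subset)
  interpret bounded_module_map A A "\<lambda>a. pA x e \<otimes>\<^bsub>A\<^esub> a" "vnorm A (pA x e)"
    using x e' by (intro contractive_bilinear_right_map[OF El.R.mult_bilinear
          El.R.normed_module_axioms El.R.normed_module_axioms]) simp
  have "pA x e \<otimes>\<^bsub>A\<^esub> pA y f \<in> J" if "y \<in> carrier Er" "f \<in> carrier El" for y f
  proof -
    have "pA x e \<otimes>\<^bsub>A\<^esub> pA y f = pA x (la e (pA y f))"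
      using that x e' by (simp add: pA_right)
    also have "\<dots> = pA (rb x (pB e y)) f"
      using that x e' by (simp add: pA_balanced flip: compatible_left)
    also have "\<dots> \<in> J"
      using that x e by (intro pA_Nr rb_I pB_Nl)
    finally show ?thesis .
  qed
  then have "(\<lambda>a. pA x e \<otimes>\<^bsub>A\<^esub> a) ` ?S \<subseteq> J" by auto
  moreover have "?S \<subseteq> carrier A" by auto
  ultimately have mult: "pA x e \<otimes>\<^bsub>A\<^esub> a \<in> J" if "a \<in> carrier A" for a
    using image_closed_span[OF J.submodule_N J.closedin_N] that pA_full by blast
  \<comment> \<open>The witness is the product of \<open>pA x e\<close> with an approximate right
    unit; \<open>mult\<close> puts it into \<open>J\<close>.\<close>
  have "\<exists>z\<in>J. vnorm A (pA x e \<ominus>\<^bsub>A\<^esub> z) < \<epsilon>" if "\<epsilon> > 0" for \<epsilon>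
  proof -
    obtain u where "u \<in> carrier A" "vnorm A (pA x e \<otimes>\<^bsub>A\<^esub> u \<ominus>\<^bsub>A\<^esub> pA x e) < \<epsilon>"
      using right_approximate_unit[of "pA x e" \<epsilon>] \<open>\<epsilon> > 0\<close> x e' by auto
    then show ?thesis
      using mult x e' by (metis El.R.vnorm_minus_commute action_closed(6) mult_closed(2))
  qed
  then show ?thesis
    using J.closedin_N x e' unfolding El.R.closedin_iff by simp
qed

lemmas closed_submodules = I.closed_submodule_axioms J.closed_submodule_axioms
  Nl.closed_submodule_axioms Nr.closed_submodule_axioms

text \<open>In this and the following instances the three sets are the submodules divided out of the
  first argument, the second argument and the values. The absorption conditions are the membership
  lemmas above.\<close>

sublocale bl: bilinear_quotient B El El I Nl Nl bl
  by (intro bilinear_quotient.intro bilinear_quotient_axioms.intro closed_submodules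
      El.left_bilinear bl_I bl_Nl)

sublocale la: bilinear_quotient El A El Nl J Nl la
  by (intro bilinear_quotient.intro bilinear_quotient_axioms.intro closed_submodules
      El.right_bilinear la_J la_Nl)

sublocale ar: bilinear_quotient A Er Er J Nr Nr ar
  by (intro bilinear_quotient.intro bilinear_quotient_axioms.intro closed_submodules
      Er.left_bilinear ar_J ar_Nr)

sublocale rb: bilinear_quotient Er B Er Nr I Nr rb
  by (intro bilinear_quotient.intro bilinear_quotient_axioms.intro closed_submodules
      Er.right_bilinear rb_I rb_Nr)

sublocale pB: bilinear_quotient El Er B Nl Nr I pB
  by (intro bilinear_quotient.intro bilinear_quotient_axioms.intro closed_submodules
      pB_bilinear pB_Nl pB_Nr)

sublocale pA: bilinear_quotient Er El A Nr Nl J pA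
  by (intro bilinear_quotient.intro bilinear_quotient_axioms.intro closed_submodules
      pA_bilinear pA_Nl pA_Nr)

sublocale mA: bilinear_quotient A A A J J J "mult A"
  by (rule El.R.bilinear_quotient_mult[OF closed_ideal_J])

sublocale mB: bilinear_quotient B B B I I I "mult B"
  by (rule El.L.bilinear_quotient_mult[OF closed_ideal_I])

lemmas induced_map_cosets = bl.induced_map_coset la.induced_map_coset ar.induced_map_coset
  rb.induced_map_coset pB.induced_map_coset pA.induced_map_coset mA.induced_map_coset
  mB.induced_map_coset

lemma morita_equivalence_quotient:
  "morita_equivalence J.Q I.Q Nl.Q Nr.Q (induced_map El Nl bl) (induced_map El Nl la)
    (induced_map Er Nr ar) (induced_map Er Nr rb) (induced_map B I pB) (induced_map A J pA)"
proof (intro morita_equivalence.intro morita_equivalence_axioms.intro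
    El.banach_bimodule_quotient Er.banach_bimodule_quotient closed_ideal_I closed_ideal_J
    Nl.closed_banach_submodule_axioms Nr.closed_banach_submodule_axioms
    bl.bilinear_quotient_axioms la.bilinear_quotient_axioms
    ar.bilinear_quotient_axioms rb.bilinear_quotient_axioms
    pB.induced_map_bilinear pA.induced_map_bilinear
    pB.induced_map_full pA.induced_map_full pB_full pA_full
    bl.induced_map_full la.induced_map_full ar.induced_map_full rb.induced_map_full
    bl_nondegenerate la_nondegenerate ar_nondegenerate rb_nondegenerate)
\<comment> \<open>The goals left are the algebraic identities. Every coset is replaced by a
  representative, and \<open>induced_map_cosets\<close> reduces each identity to the original
  one.\<close>
qed (auto elim!: I.carrier_quotientE J.carrier_quotientE Nl.carrier_quotientE Nr.carrier_quotientE
    simp: mult_quotient induced_map_cosets pB_left pB_right pA_left pA_right pB_balanced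
      pA_balanced compatible_left compatible_right)

end

section \<open>The quotient theorem\<close>

text \<open>The index order is reflexive, so the estimate holding beyond an index also holds at that
  index.\<close>

lemma bounded_approximate_identity_right:
  assumes "bounded_approximate_identity A D dle u" "a \<in> carrier A" "\<epsilon> > 0"
  shows "\<exists>u\<in>carrier A. vnorm A (a \<otimes>\<^bsub>A\<^esub> u \<ominus>\<^bsub>A\<^esub> a) < \<epsilon>"
  using assms unfolding bounded_approximate_identity_def by blast

theorem theorem2p14:
  fixes A :: "'a normed_struct" and B :: "'b normed_struct"
    and El :: "'e normed_struct" and Er :: "'f normed_struct"
    and bl :: "'b \<Rightarrow> 'e \<Rightarrow> 'e" and la :: "'e \<Rightarrow> 'a \<Rightarrow> 'e"
    and ar :: "'a \<Rightarrow> 'f \<Rightarrow> 'f" and rb :: "'f \<Rightarrow> 'b \<Rightarrow> 'f"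
    and pB :: "'e \<Rightarrow> 'f \<Rightarrow> 'b" and pA :: "'f \<Rightarrow> 'e \<Rightarrow> 'a"
    and DA :: "'i set" and leA :: "'i \<Rightarrow> 'i \<Rightarrow> bool" and uA :: "'i \<Rightarrow> 'a"
    and DB :: "'j set" and leB :: "'j \<Rightarrow> 'j \<Rightarrow> bool" and uB :: "'j \<Rightarrow> 'b"
    and I :: "'b set" and J :: "'a set" and Nl :: "'e set" and Nr :: "'f set"
  assumes "banach_algebra A" and "banach_algebra B"
    and "bounded_approximate_identity A DA leA uA"
    and "bounded_approximate_identity B DB leB uB"
    and "morita_equivalence A B El Er bl la ar rb pB pA"
    and "closed_ideal B I"
    and "J = induced_ideal A El Er pB pA I"
    and "Nr = right_part El Er pB I"
    and "Nl = left_part El Er pB I"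
  shows "closed_ideal A J \<and>
         morita_equivalence (quotient_struct A J) (quotient_struct B I)
           (quotient_struct El Nl) (quotient_struct Er Nr)
           (induced_map El Nl bl) (induced_map El Nl la)
           (induced_map Er Nr ar) (induced_map Er Nr rb)
           (induced_map B I pB) (induced_map A J pA) \<and>
         (\<forall>b\<in>carrier B. \<forall>\<eta>\<in>carrier El.
           induced_map El Nl bl (I +>\<^bsub>B\<^esub> b) (Nl +>\<^bsub>El\<^esub> \<eta>) = Nl +>\<^bsub>El\<^esub> bl b \<eta>) \<and>
         (\<forall>\<eta>\<in>carrier El. \<forall>a\<in>carrier A.
           induced_map El Nl la (Nl +>\<^bsub>El\<^esub> \<eta>) (J +>\<^bsub>A\<^esub> a) = Nl +>\<^bsub>El\<^esub> la \<eta> a) \<and>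
         (\<forall>a\<in>carrier A. \<forall>\<xi>\<in>carrier Er.
           induced_map Er Nr ar (J +>\<^bsub>A\<^esub> a) (Nr +>\<^bsub>Er\<^esub> \<xi>) = Nr +>\<^bsub>Er\<^esub> ar a \<xi>) \<and>
         (\<forall>\<xi>\<in>carrier Er. \<forall>b\<in>carrier B.
           induced_map Er Nr rb (Nr +>\<^bsub>Er\<^esub> \<xi>) (I +>\<^bsub>B\<^esub> b) = Nr +>\<^bsub>Er\<^esub> rb \<xi> b) \<and>
         (\<forall>\<eta>\<in>carrier El. \<forall>\<xi>\<in>carrier Er.
           induced_map B I pB (Nl +>\<^bsub>El\<^esub> \<eta>) (Nr +>\<^bsub>Er\<^esub> \<xi>) = I +>\<^bsub>B\<^esub> pB \<eta> \<xi>) \<and>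
         (\<forall>\<xi>\<in>carrier Er. \<forall>\<eta>\<in>carrier El.
           induced_map A J pA (Nr +>\<^bsub>Er\<^esub> \<xi>) (Nl +>\<^bsub>El\<^esub> \<eta>) = J +>\<^bsub>A\<^esub> pA \<xi> \<eta>)"
proof -
  interpret morita_ideal A B El Er bl la ar rb pB pA I
    using assms(5,6) bounded_approximate_identity_right[OF assms(3)]
    by (simp add: morita_ideal_def morita_ideal_axioms_def)
  show ?thesis
    unfolding assms(7-9)
    using closed_ideal_J morita_equivalence_quotient by (simp add: induced_map_cosets)
qed

end
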